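(* Let $G$ be an Abelian group admitting a pseudocompact group topology, and fix a decomposition $G=\left(\bigoplus_{p^k\in P_0}\bigoplus_{\gamma(p^k)}\mathbb{Z}(p^k)\right)\oplus H$ where $P_0$ is a finite set of prime powers, each $\gamma(p^k)$ is a cardinal, and $H$ is a subgroup with $|nH|=|H|$ for all $n\in\mathbb{N}$. Let $P_1=\{p^k\in P_0:\gamma(p^k)>r_0(G)\}$ and $G_0=\left(\bigoplus_{p^k\in P_0\setminus P_1}\bigoplus_{\gamma(p^k)}\mathbb{Z}(p^k)\right)\oplus H$, so that $G=\left(\bigoplus_{p^k\in P_1}\bigoplus_{\gamma(p^k)}\mathbb{Z}(p^k)\right)\oplus G_0$. Suppose that each dominant rank $\gamma(p^k)$, $p^k\in P_1$, satisfies property $(\ast)$, and that $r_0(G)$ satisfies property $(\ast)$ for some cardinal $\kappa$ (i.e. $\kappa^\omega\le r_0(G)\le 2^\kappa$) with $m(|G_0|)\leq 2^\kappa$. Then $G$ admits a pseudocompact group topology with property $\mathfrak{h}$.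
   Context: $\mathbb{Z}(p^k)$ is the cyclic group of order $p^k$; $\bigoplus_{\gamma}$ denotes a direct sum of $\gamma$ copies; $r_0(G)$ is the torsion-free rank of $G$. The cardinals $\gamma(p^k)$ with $p^k\in P_1$ are called the dominant ranks of $G$. An infinite cardinal $\alpha$ satisfies property $(\ast)$ if there is a cardinal $\kappa$ with $\kappa^\omega\le\alpha\le 2^\kappa$. For an infinite cardinal $\alpha$, $m(\alpha)$ is the least cardinality of a $G_\delta$-dense subset (a subset meeting every nonempty $G_\delta$-subset) of a compact group of weight $\alpha$; this does not depend on the compact group chosen. A space is pseudocompact if every real continuous function on it is bounded. A subgroup $N$ of a topological Abelian group $K$ is $h$-embedded if every homomorphism $N\to\mathbb{T}$ extends to a continuous homomorphism $K\to\mathbb{T}$; $K$ has property $\mathfrak{h}$ if every countable subgroup of $K$ is $h$-embedded in $K$. *)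

theory Defs
  imports "HOL-Analysis.Analysis" "HOL-Algebra.Algebra" "HOL-Library.Equipollence"
begin

definition group_topology :: "('a, 'b) monoid_scheme \<Rightarrow> 'a topology \<Rightarrow> bool" where
  "group_topology G T \<equiv>
     topspace T = carrier G \<and> Hausdorff_space T \<and>
     continuous_map (prod_topology T T) T (\<lambda>(x, y). monoid.mult G x y) \<and>
     continuous_map T T (m_inv G)"

definition pseudocompact_space :: "'a topology \<Rightarrow> bool" where
  "pseudocompact_space T \<equiv>
     (\<forall>f. continuous_map T euclideanreal f \<longrightarrow> bounded (f ` topspace T))"

definition circle_group :: "complex monoid" where
  "circle_group \<equiv> \<lparr>carrier = sphere 0 1, monoid.mult = (*), one = 1\<rparr>"

definition circle_top :: "complex topology" where
  "circle_top \<equiv> top_of_set (sphere 0 1)"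

definition h_embedded :: "('a, 'b) monoid_scheme \<Rightarrow> 'a topology \<Rightarrow> 'a set \<Rightarrow> bool" where
  "h_embedded G T N \<equiv>
     (\<forall>f \<in> hom (subgroup_generated G N) circle_group.
        \<exists>g \<in> hom G circle_group. continuous_map T circle_top g \<and> (\<forall>x\<in>N. g x = f x))"

definition property_h :: "('a, 'b) monoid_scheme \<Rightarrow> 'a topology \<Rightarrow> bool" where
  "property_h G T \<equiv> (\<forall>N. subgroup N G \<and> countable N \<longrightarrow> h_embedded G T N)"

text \<open>Independent sets (of elements of infinite order); the torsion-free rank r_0(G)
  is the cardinality of any maximal such set.\<close>
definition tf_independent :: "('a, 'b) monoid_scheme \<Rightarrow> 'a set \<Rightarrow> bool" where
  "tf_independent G R \<equiv> R \<subseteq> carrier G \<and>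
     (\<forall>F (m :: 'a \<Rightarrow> int). finite F \<and> F \<subseteq> R \<and>
        finprod G (\<lambda>x. x [^]\<^bsub>G\<^esub> m x) F = \<one>\<^bsub>G\<^esub> \<longrightarrow> (\<forall>x\<in>F. m x = 0))"

definition tf_rank_basis :: "('a, 'b) monoid_scheme \<Rightarrow> 'a set \<Rightarrow> bool" where
  "tf_rank_basis G R \<equiv> tf_independent G R \<and>
     (\<forall>S. tf_independent G S \<and> R \<subseteq> S \<longrightarrow> S = R)"

definition star_wit :: "'k set \<Rightarrow> 'a set \<Rightarrow> bool" where
  "star_wit K A \<equiv> Pi (UNIV :: nat set) (\<lambda>_. K) \<lesssim> A \<and> A \<lesssim> Pow K"

text \<open>Property (*) for the cardinal |A| (witness kappa may be taken of size at most |A|).\<close>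
definition star :: "'a set \<Rightarrow> bool" where
  "star A \<equiv> infinite A \<and> (\<exists>K :: 'a set. star_wit K A)"

definition prime_powers :: "nat set" where
  "prime_powers \<equiv> {q. \<exists>p k. Factorial_Ring.prime p \<and> k \<ge> 1 \<and> q = p ^ k}"

definition Dsum :: "nat set \<Rightarrow> (nat \<Rightarrow> 'i set) \<Rightarrow> (nat \<Rightarrow> 'i \<Rightarrow> int) monoid" where
  "Dsum P \<gamma> \<equiv> sum_group P (\<lambda>q. sum_group (\<gamma> q) (\<lambda>_. integer_mod_group q))"

definition dominant :: "nat set \<Rightarrow> (nat \<Rightarrow> 'i set) \<Rightarrow> 'a set \<Rightarrow> nat set" where
  "dominant P0 \<gamma> R \<equiv> {q \<in> P0. R \<prec> \<gamma> q}"

text \<open>G_delta-dense subsets; the compact group of weight |W| is taken as the torus T^W.\<close>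
definition gdelta_dense :: "'a topology \<Rightarrow> 'a set \<Rightarrow> bool" where
  "gdelta_dense T D \<equiv> D \<subseteq> topspace T \<and>
     (\<forall>S. gdelta_in T S \<and> S \<noteq> {} \<longrightarrow> S \<inter> D \<noteq> {})"

definition torus :: "'w set \<Rightarrow> ('w \<Rightarrow> complex) topology" where
  "torus W \<equiv> product_topology (\<lambda>_. circle_top) W"

definition m_le :: "'w set \<Rightarrow> 'b set \<Rightarrow> bool" where
  "m_le W B \<equiv> (\<exists>D. gdelta_dense (torus W) D \<and> D \<lesssim> B)"

end

theory Submission
  imports Defs
begin

text \<open>The torus-valued characters of \<open>G\<close> induce on \<open>G\<close> group topologies. Let \<open>Y\<close> be a set of characters
  with two interpolation properties: prescribed values (taken from the ranges) on countably many members of \<open>Y\<close> are attained at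
  some \<open>g \<in> G\<close>, and every character of \<open>G\<close> agrees on every countable set with a product of members of \<open>Y\<close>. The first
  property makes the topology induced by \<open>Y\<close> pseudocompact, the second yields property \<open>h\<close>. Such families
  pass to finite products, so it suffices to find one on each \<open>\<Oplus>\<^bsub>\<gamma>(q)\<^esub> \<int>(q)\<close> with \<open>q\<close> dominant, and one on \<open>G\<^sub>0\<close>.

  Property \<open>(*)\<close> yields matrices whose rows and columns both interpolate arbitrary values on countable sets. For
  \<open>\<int>(q)\<close>-sums such a matrix, indexed by the basis on both sides, is the desired family. For \<open>G\<^sub>0\<close> the matrix prescribes the
  values of \<open>2\<^sup>\<kappa>\<close> characters on a maximal independent set, and the characters are then extended to
  \<open>G\<^sub>0\<close> following the advice of a \<open>G\<^sub>\<delta>\<close>-dense set of at most \<open>2\<^sup>\<kappa>\<close> functions from \<open>G\<^sub>0\<close> to the circle.\<close>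

section \<open>Characters of abelian groups\<close>

text \<open>A character prescribed on an independent set extends to \<open>G\<close> by divisibility
  of the circle, but such an extension says nothing about its values elsewhere, while property h
  asks for agreement on every countable set. Treating each character of \<open>G\<close> separately
  is out of reach, since only 2^kappa columns are available. The members of a G_delta-dense set
  match every prescription on countably many coordinates and are few enough, yet they need not be
  homomorphisms. They can only serve as proposals; the point of the recursion is that a proposal
  agreeing with a character on a suitably closed countable set is never overruled on that set. The
  hypothesis bounds m(|G_0|) and not m(|G|), so the dominant summands must do without proposals.
  They can, because a character of a direct sum of copies of Z(q) is given by arbitrary q-th roots
  of unity on the generators.\<close>

lemma carrier_circle [simp]: "carrier circle_group = sphere 0 1"
  and mult_circle [simp]: "x \<otimes>\<^bsub>circle_group\<^esub> y = x * y"
  and one_circle [simp]: "\<one>\<^bsub>circle_group\<^esub> = 1"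
  by (auto simp: circle_group_def)

lemma comm_group_circle: "comm_group circle_group"
proof (rule comm_groupI)
  fix x :: complex assume "x \<in> carrier circle_group"
  then show "\<exists>y\<in>carrier circle_group. y \<otimes>\<^bsub>circle_group\<^esub> x = \<one>\<^bsub>circle_group\<^esub>"
    by (intro bexI[of _ "inverse x"]) (auto simp: norm_inverse intro!: left_inverse)
qed (auto simp: norm_mult)

lemma group_circle: "group circle_group"
  using comm_group_circle by (simp add: comm_group_def)

lemma inv_circle: "x \<in> sphere 0 1 \<Longrightarrow> inv\<^bsub>circle_group\<^esub> x = inverse x"
  by (rule group.inv_equality[OF group_circle]) (auto simp: norm_inverse intro!: left_inverse)

lemma nat_pow_circle: "x [^]\<^bsub>circle_group\<^esub> (n::nat) = x ^ n"
proof (induction n)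
  case (Suc n)
  interpret group circle_group by (rule group_circle)
  show ?case using Suc by simp
qed (use group_circle in \<open>simp add: group_def monoid.nat_pow_0\<close>)

lemma int_pow_circle: "x \<in> sphere 0 1 \<Longrightarrow> x [^]\<^bsub>circle_group\<^esub> (n::int) = x powi n"
proof -
  assume x: "x \<in> sphere 0 1"
  interpret group circle_group by (rule group_circle)
  show ?thesis
    using x nat_pow_closed[of x "nat (-n)"]
    by (auto simp: int_pow_def2 nat_pow_circle power_int_def inv_circle norm_power power_inverse)
qed

lemma circle_divisible:
  assumes "w \<in> sphere 0 1" "n > 0"
  obtains v where "v \<in> sphere 0 1" "v ^ n = (w::complex)"
proof -
  have "w \<noteq> 0" using assms by auto
  then have "cis (Arg w) = w"
    using assms cis_Arg[of w] by (auto simp: sgn_div_norm)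
  then have "cis (Arg w / n) ^ n = w"
    using assms by (subst Complex.DeMoivre) auto
  then show ?thesis
    by (intro that[of "cis (Arg w / n)"]) auto
qed

section \<open>Partial characters as subgroups of the product of \<open>G\<close> with the
  circle\<close>

lemma int_pow_DirProd:
  assumes "group G" "group H" "x \<in> carrier G" "y \<in> carrier H"
  shows "(x, y) [^]\<^bsub>G \<times>\<times> H\<^esub> (n::int) = (x [^]\<^bsub>G\<^esub> n, y [^]\<^bsub>H\<^esub> n)"
proof -
  interpret G: group G by fact
  interpret H: group H by fact
  interpret GH: group "G \<times>\<times> H" by (rule DirProd_group) fact+
  have p: "(x, y) [^]\<^bsub>G \<times>\<times> H\<^esub> (m::nat) = (x [^]\<^bsub>G\<^esub> m, y [^]\<^bsub>H\<^esub> m)" for m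
    by (induction m) auto
  show ?thesis
    using assms unfolding int_pow_def2 p
    by (cases "n < 0") (simp_all only: if_True if_False inv_DirProd G.nat_pow_closed H.nat_pow_closed)
qed

lemma comm_group_DirProd:
  assumes "comm_group G" "comm_group H"
  shows "comm_group (G \<times>\<times> H)"
proof -
  interpret G: comm_group G by fact
  interpret H: comm_group H by fact
  interpret GH: group "G \<times>\<times> H" by (rule DirProd_group) unfold_locales
  show ?thesis
    by (rule GH.group_comm_groupI) (auto simp: G.m_comm H.m_comm)
qed

lemma generate_mono: "A \<subseteq> B \<Longrightarrow> generate G A \<subseteq> generate G B"
proof
  fix x assume "x \<in> generate G A" "A \<subseteq> B"
  then show "x \<in> generate G B"
    by (induction rule: generate.induct) (auto intro: generate.intros)
qed

lemma generate_finite_support: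
  assumes "g \<in> generate G B"
  obtains F where "finite F" "F \<subseteq> B" "g \<in> generate G F"
proof -
  have "\<exists>F. finite F \<and> F \<subseteq> B \<and> g \<in> generate G F"
    using assms
  proof (induction rule: generate.induct)
    case one then show ?case by (intro exI[of _ "{}"]) (auto intro: generate.one)
  next
    case (incl h) then show ?case by (intro exI[of _ "{h}"]) (auto intro: generate.incl)
  next
    case (inv h) then show ?case by (intro exI[of _ "{h}"]) (auto intro: generate.inv)
  next
    case (eng h1 h2)
    then obtain F1 F2 where F: "finite F1" "F1 \<subseteq> B" "h1 \<in> generate G F1"
      "finite F2" "F2 \<subseteq> B" "h2 \<in> generate G F2"
      by auto
    have "h1 \<in> generate G (F1 \<union> F2)" "h2 \<in> generate G (F1 \<union> F2)"
      using F generate_mono[of F1 "F1 \<union> F2" G] generate_mono[of F2 "F1 \<union> F2" G] by auto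
    then show ?case
      using F by (intro exI[of _ "F1 \<union> F2"]) (auto intro: generate.eng)
  qed
  then show ?thesis using that by blast
qed

text \<open>A function on a mere set \<open>B\<close> is studied through the subgroup of
  \<open>G \<times>\<times> circle_group\<close> generated by its graph. This avoids choosing
  representations of group elements as products over \<open>B\<close>.\<close>

definition graph_gen :: "('a, 'b) monoid_scheme \<Rightarrow> ('a \<Rightarrow> complex) \<Rightarrow> 'a set \<Rightarrow> ('a \<times> complex) set" where
  "graph_gen G s B = generate (G \<times>\<times> circle_group) ((\<lambda>b. (b, s b)) ` B)"

text \<open>For circle-valued \<open>s\<close>, the fibres of the generated subgroup are cosets of
  its fibre over the unit. So triviality of that fibre means that the subgroup is the graph of a
  character of \<open>generate G B\<close> extending \<open>s\<close>.\<close>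

definition coherent :: "('a, 'b) monoid_scheme \<Rightarrow> ('a \<Rightarrow> complex) \<Rightarrow> 'a set \<Rightarrow> bool" where
  "coherent G s B \<longleftrightarrow> (\<forall>w. (\<one>\<^bsub>G\<^esub>, w) \<in> graph_gen G s B \<longrightarrow> w = 1)"

lemma graph_gen_cong: "(\<And>b. b \<in> B \<Longrightarrow> s b = s' b) \<Longrightarrow> graph_gen G s B = graph_gen G s' B"
  unfolding graph_gen_def by (metis (mono_tags, lifting) image_cong)

lemma coherent_cong: "(\<And>b. b \<in> B \<Longrightarrow> s b = s' b) \<Longrightarrow> coherent G s B = coherent G s' B"
  unfolding coherent_def using graph_gen_cong[of B s s' G] by simp

lemma graph_gen_mono: "A \<subseteq> B \<Longrightarrow> graph_gen G s A \<subseteq> graph_gen G s B"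
  unfolding graph_gen_def by (rule generate_mono) auto

lemma coherent_mono: "coherent G s B \<Longrightarrow> A \<subseteq> B \<Longrightarrow> coherent G s A"
  unfolding coherent_def using graph_gen_mono by blast

lemma graph_gen_finite_support:
  assumes "p \<in> graph_gen G s B"
  obtains F where "finite F" "F \<subseteq> B" "p \<in> graph_gen G s F"
proof -
  obtain F where "finite F" "F \<subseteq> (\<lambda>b. (b, s b)) ` B" "p \<in> generate (G \<times>\<times> circle_group) F"
    using assms unfolding graph_gen_def by (rule generate_finite_support)
  moreover from this obtain E where "E \<subseteq> B" "finite E" "F = (\<lambda>b. (b, s b)) ` E"
    by (meson finite_subset_image)
  ultimately show ?thesis
    using that unfolding graph_gen_def by metis
qed

context comm_group
begin

lemma subgroup_graph_gen:
  assumes "B \<subseteq> carrier G" "s \<in> B \<rightarrow> sphere 0 1"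
  shows "subgroup (graph_gen G s B) (G \<times>\<times> circle_group)"
  unfolding graph_gen_def
  by (rule group.generate_is_subgroup[OF DirProd_group[OF is_group group_circle]]) (use assms in auto)

text \<open>The graph of \<open>f\<close> is itself a subgroup and contains the generators.\<close>

lemma graph_gen_hom:
  assumes "B \<subseteq> carrier G" and hom: "f \<in> hom G circle_group" and eq: "\<And>b. b \<in> B \<Longrightarrow> s b = f b"
    and "(g, w) \<in> graph_gen G s B"
  shows "w = f g"
proof -
  interpret C: group circle_group by (rule group_circle)
  have "subgroup {(g, w). g \<in> carrier G \<and> w = f g} (G \<times>\<times> circle_group)"
  proof (rule group.subgroupI[OF DirProd_group[OF is_group group_circle]])
    interpret H: group_hom G circle_group f
      by unfold_locales (rule hom)
    show "{(g, w). g \<in> carrier G \<and> w = f g} \<noteq> {}"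
      by auto
    show "{(g, w). g \<in> carrier G \<and> w = f g} \<subseteq> carrier (G \<times>\<times> circle_group)"
      using H.hom_closed by auto
    fix a assume a: "a \<in> {(g, w). g \<in> carrier G \<and> w = f g}"
    then show "inv\<^bsub>G \<times>\<times> circle_group\<^esub> a \<in> {(g, w). g \<in> carrier G \<and> w = f g}"
      using H.hom_closed by (auto simp: inv_DirProd[OF is_group group_circle])
    fix b assume b: "b \<in> {(g, w). g \<in> carrier G \<and> w = f g}"
    then show "a \<otimes>\<^bsub>G \<times>\<times> circle_group\<^esub> b \<in> {(g, w). g \<in> carrier G \<and> w = f g}"
      using a H.hom_mult by auto
  qed
  then have "graph_gen G s B \<subseteq> {(g, w). g \<in> carrier G \<and> w = f g}"
    unfolding graph_gen_def
    by (intro group.generate_subgroup_incl[OF DirProd_group[OF is_group group_circle]])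
       (use assms in auto)
  then show ?thesis using assms(4) by auto
qed

text \<open>Multiplicativity is read off from (x, s x)(y, s y)(xy, s(xy))^-1, a member of the
  generated subgroup lying over the unit.\<close>

lemma coherent_carrier_imp_hom:
  assumes s: "s \<in> carrier G \<rightarrow> sphere 0 1" and c: "coherent G s (carrier G)"
  shows "s \<in> hom G circle_group"
proof (rule homI)
  interpret S: subgroup "graph_gen G s (carrier G)" "G \<times>\<times> circle_group"
    using s by (intro subgroup_graph_gen) auto
  fix x y assume xy: "x \<in> carrier G" "y \<in> carrier G"
  have i: "(z, s z) \<in> graph_gen G s (carrier G)" if "z \<in> carrier G" for z
    using that unfolding graph_gen_def by (intro generate.incl) auto
  have "(x, s x) \<otimes>\<^bsub>G \<times>\<times> circle_group\<^esub> (y, s y) \<otimes>\<^bsub>G \<times>\<times> circle_group\<^esub>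
      inv\<^bsub>G \<times>\<times> circle_group\<^esub> (x \<otimes> y, s (x \<otimes> y)) \<in> graph_gen G s (carrier G)"
    using xy by (intro S.m_closed S.m_inv_closed i) auto
  moreover have "s (x \<otimes> y) \<in> sphere 0 1"
    using s xy by auto
  ultimately have "(\<one>, s x * s y * inverse (s (x \<otimes> y))) \<in> graph_gen G s (carrier G)"
    using xy by (simp add: is_group group_circle inv_circle)
  then have "s x * s y * inverse (s (x \<otimes> y)) = 1"
    using c by (auto simp: coherent_def)
  then show "s (x \<otimes> y) = s x \<otimes>\<^bsub>circle_group\<^esub> s y"
    using \<open>s (x \<otimes> y) \<in> sphere 0 1\<close> by (auto simp: field_simps)
qed (use s in auto)

text \<open>The exponents n for which x^n occurs as a first component of \<Gamma> form a subgroup of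
  the integers. If it is generated by some k > 0, any k-th root of the value over x^k will do, and
  divisibility of the circle provides one; if it is zero, there is no constraint.\<close>

lemma single_valued_extension:
  assumes \<Gamma>: "subgroup \<Gamma> (G \<times>\<times> circle_group)" and sv: "\<And>w. (\<one>, w) \<in> \<Gamma> \<Longrightarrow> w = 1"
    and x: "x \<in> carrier G"
  obtains v where "v \<in> sphere 0 1" "\<And>n w. (x [^] (n::int), w) \<in> \<Gamma> \<Longrightarrow> w = v powi n"
proof (cases "\<exists>k>0. \<exists>w. (x [^] (k::nat), w) \<in> \<Gamma>")
  case True
  interpret S: subgroup \<Gamma> "G \<times>\<times> circle_group" by fact
  interpret GC: group "G \<times>\<times> circle_group" by (rule DirProd_group[OF is_group group_circle])
  define k where "k = (LEAST k. k > 0 \<and> (\<exists>w. (x [^] (k::nat), w) \<in> \<Gamma>))"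
  have k: "k > 0" "\<exists>w. (x [^] k, w) \<in> \<Gamma>"
    using LeastI_ex[of "\<lambda>k. k > 0 \<and> (\<exists>w. (x [^] (k::nat), w) \<in> \<Gamma>)"] True unfolding k_def by auto
  have kmin: "i \<ge> k" if "i > 0" "(x [^] i, w) \<in> \<Gamma>" for i w
    unfolding k_def by (rule Least_le) (use that in auto)
  obtain w0 where w0: "(x [^] int k, w0) \<in> \<Gamma>"
    using k by (auto simp: int_pow_int)
  have w0c: "w0 \<in> sphere 0 1"
    using S.mem_carrier[OF w0] by simp
  obtain v where v: "v \<in> sphere 0 1" "v ^ k = w0"
    using circle_divisible[OF w0c k(1)] by blast
  show ?thesis
  proof (rule that[OF v(1)])
    fix n :: int and w assume w: "(x [^] n, w) \<in> \<Gamma>"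
    have wc: "w \<in> sphere 0 1"
      using S.mem_carrier[OF w] by simp
    \<comment> \<open>Division with remainder: removing the multiple of \<open>k\<close> leaves a
      power of \<open>x\<close> with exponent below \<open>k\<close>, which minimality forces to be
      zero.\<close>
    define j i where "j = n div int k" and "i = nat (n mod int k)"
    have n: "n = int k * j + int i"
      using k by (simp add: j_def i_def)
    have ilt: "i < k" using k by (simp add: i_def nat_less_iff)
    have "(x [^] n, w) \<otimes>\<^bsub>G \<times>\<times> circle_group\<^esub> ((x [^] int k, w0) [^]\<^bsub>G \<times>\<times> circle_group\<^esub> (- j)) \<in> \<Gamma>"
      by (intro S.m_closed w GC.subgroup_int_pow_closed[OF \<Gamma>] w0)
    then have *: "(x [^] int i, w * w0 powi (-j)) \<in> \<Gamma>"
      using x w0c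
      by (simp add: int_pow_DirProd is_group group_circle int_pow_circle int_pow_pow n flip: int_pow_mult)
    then have "i = 0"
      using kmin[of i] ilt by (metis int_pow_int not_le gr0I)
    with * have "w * w0 powi (-j) = 1"
      using sv by simp
    then have "w = w0 powi j"
      using w0c by (auto simp: power_int_minus field_simps)
    also have "\<dots> = v powi n"
      using \<open>i = 0\<close> v by (auto simp: n power_int_mult)
    finally show "w = v powi n" .
  qed
next
  case False
  interpret S: subgroup \<Gamma> "G \<times>\<times> circle_group" by fact
  \<comment> \<open>Only the exponent 0 occurs here, so every value is admissible and 1 is
    taken.\<close>
  show ?thesis
  proof (rule that[of 1])
    fix n :: int and w assume w: "(x [^] n, w) \<in> \<Gamma>"
    have wc: "w \<in> sphere 0 1"
      using S.mem_carrier[OF w] by simp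
    have "inv\<^bsub>G \<times>\<times> circle_group\<^esub> (x [^] n, w) \<in> \<Gamma>"
      using w by (rule S.m_inv_closed)
    then have "(x [^] (-n), inverse w) \<in> \<Gamma>"
      using x wc by (simp add: is_group group_circle inv_circle int_pow_neg)
    then have "n = 0"
      using False w x by (metis int_pow_int linorder_neqE_linordered_idom neg_0_less_iff_less pos_int_cases)
    then show "w = 1 powi n"
      using w sv by simp
  qed auto
qed

text \<open>The products of a member of the old subgroup with a power of \<open>(x, v)\<close> form
  a subgroup containing all generators. A product lying over the unit has a first factor over
  x^(-n), where \<open>ext\<close> determines the value, and the two contributions cancel.\<close>

lemma coherent_insert:
  assumes B: "B \<subseteq> carrier G" and s: "s \<in> B \<rightarrow> sphere 0 1" and x: "x \<in> carrier G" "x \<notin> B"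
    and c: "coherent G s B" and v: "v \<in> sphere 0 1"
    and ext: "\<And>n w. (x [^] (n::int), w) \<in> graph_gen G s B \<Longrightarrow> w = v powi n"
  shows "coherent G (s(x := v)) (insert x B)"
proof -
  let ?P = "G \<times>\<times> circle_group"
  interpret S: subgroup "graph_gen G s B" ?P
    by (rule subgroup_graph_gen[OF B s])
  interpret GC: comm_group ?P by (rule comm_group_DirProd[OF comm_group_axioms comm_group_circle])
  have xv: "(x, v) \<in> carrier ?P" using x v by simp
  define \<Delta> where "\<Delta> = {p \<otimes>\<^bsub>?P\<^esub> ((x, v) [^]\<^bsub>?P\<^esub> (n::int)) | p n. p \<in> graph_gen G s B}"
  have "subgroup \<Delta> ?P"
  proof (rule GC.subgroupI)
    show "\<Delta> \<subseteq> carrier ?P"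
      using xv S.mem_carrier unfolding \<Delta>_def by blast
    show "\<Delta> \<noteq> {}"
      using S.one_closed unfolding \<Delta>_def by blast
  next
    fix a assume "a \<in> \<Delta>"
    then obtain p n where a: "p \<in> graph_gen G s B" "a = p \<otimes>\<^bsub>?P\<^esub> ((x, v) [^]\<^bsub>?P\<^esub> (n::int))"
      unfolding \<Delta>_def by blast
    then have "inv\<^bsub>?P\<^esub> a = (inv\<^bsub>?P\<^esub> p) \<otimes>\<^bsub>?P\<^esub> ((x, v) [^]\<^bsub>?P\<^esub> (-n))"
      using xv S.mem_carrier[OF a(1)] by (simp add: GC.inv_mult GC.int_pow_neg del: inv_DirProd mult_DirProd carrier_DirProd)
    then show "inv\<^bsub>?P\<^esub> a \<in> \<Delta>"
      using a S.m_inv_closed unfolding \<Delta>_def by blast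
  next
    fix a b assume "a \<in> \<Delta>" "b \<in> \<Delta>"
    then obtain p n q m where a: "p \<in> graph_gen G s B" "a = p \<otimes>\<^bsub>?P\<^esub> ((x, v) [^]\<^bsub>?P\<^esub> (n::int))"
      and b: "q \<in> graph_gen G s B" "b = q \<otimes>\<^bsub>?P\<^esub> ((x, v) [^]\<^bsub>?P\<^esub> (m::int))"
      unfolding \<Delta>_def by blast
    then have "a \<otimes>\<^bsub>?P\<^esub> b = (p \<otimes>\<^bsub>?P\<^esub> q) \<otimes>\<^bsub>?P\<^esub> ((x, v) [^]\<^bsub>?P\<^esub> (n + m))"
      using xv S.mem_carrier[OF a(1)] S.mem_carrier[OF b(1)]
      by (simp add: GC.int_pow_mult GC.m_ac del: inv_DirProd mult_DirProd carrier_DirProd)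
    then show "a \<otimes>\<^bsub>?P\<^esub> b \<in> \<Delta>"
      using a b S.m_closed unfolding \<Delta>_def by blast
  qed
  moreover have "(\<lambda>b. (b, (s(x := v)) b)) ` insert x B \<subseteq> \<Delta>"
  proof safe
    fix b assume "b \<in> B"
    then have "(b, s b) \<in> graph_gen G s B"
      unfolding graph_gen_def by (intro generate.incl) auto
    then have "(b, s b) \<otimes>\<^bsub>?P\<^esub> ((x, v) [^]\<^bsub>?P\<^esub> (0::int)) \<in> \<Delta>"
      unfolding \<Delta>_def by blast
    moreover have "(b, (s(x := v)) b) = (b, s b)"
      using \<open>b \<in> B\<close> x by auto
    ultimately show "(b, (s(x := v)) b) \<in> \<Delta>"
      using \<open>b \<in> B\<close> B by auto
  next
    have "\<one>\<^bsub>?P\<^esub> \<otimes>\<^bsub>?P\<^esub> ((x, v) [^]\<^bsub>?P\<^esub> (1::int)) \<in> \<Delta>"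
      unfolding \<Delta>_def using S.one_closed by blast
    then show "(x, (s(x := v)) x) \<in> \<Delta>"
      using xv GC.l_one[OF xv] GC.int_pow_1[OF xv] by simp
  qed
  ultimately have sub: "graph_gen G (s(x := v)) (insert x B) \<subseteq> \<Delta>"
    unfolding graph_gen_def by (intro GC.generate_subgroup_incl)
  show ?thesis
    unfolding coherent_def
  proof (intro allI impI)
    fix w assume "(\<one>, w) \<in> graph_gen G (s(x := v)) (insert x B)"
    then obtain p n where p: "p \<in> graph_gen G s B" "(\<one>, w) = p \<otimes>\<^bsub>?P\<^esub> ((x, v) [^]\<^bsub>?P\<^esub> (n::int))"
      using sub unfolding \<Delta>_def by blast
    obtain g u where gu: "p = (g, u)" by (cases p)
    have gc: "g \<in> carrier G" "u \<in> sphere 0 1"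
      using S.mem_carrier[OF p(1)] gu by auto
    have "\<one> = g \<otimes> x [^] n" and w: "w = u * v powi n"
      using p gu x v by (auto simp: int_pow_DirProd is_group group_circle int_pow_circle)
    then have "g = x [^] (-n)"
      using gc x by (metis int_pow_closed int_pow_neg inv_equality inv_inv)
    then have "u = v powi (-n)"
      using ext p gu by auto
    moreover have "v \<noteq> 0" using v by auto
    ultimately show "w = 1"
      using w by (simp add: power_int_minus)
  qed
qed

end

section \<open>Transfinite construction of characters\<close>

text \<open>Placing \<open>B\<close> first makes sure that the values prescribed on \<open>B\<close>
  are fixed before any other element can restrict them. The order is lexicographic, with membership
  in \<open>B\<close> compared before a well-order of the whole type.\<close>

lemma initial_wf_order:
  obtains L :: "'a rel" where "wf L" "trans L" "total L" "\<And>x z. z \<in> B \<Longrightarrow> (x, z) \<in> L \<Longrightarrow> x \<in> B"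
proof -
  obtain r :: "'a rel" where r: "Well_order r" "Field r = UNIV"
    using well_ordering[where 'a = 'a] by blast
  define h where "h = (\<lambda>x. (if x \<in> B then 0 else 1 :: nat, x))"
  have wf: "wf (r - Id)" and tot: "total r" and tr: "trans r" and anti: "antisym r"
    using r unfolding order_on_defs by auto
  have tr': "trans (r - Id)"
    using tr anti by (rule trans_diff_Id)
  show ?thesis
  proof (rule that[of "inv_image (less_than <*lex*> (r - Id)) h"])
    show "trans (inv_image (less_than <*lex*> (r - Id)) h)"
      by (intro trans_inv_image trans_lex_prod tr' trans_less_than)
    show "total (inv_image (less_than <*lex*> (r - Id)) h)"
      using tot by (auto simp: total_on_def h_def)
    show "wf (inv_image (less_than <*lex*> (r - Id)) h)"
      by (intro wf_inv_image wf_lex_prod wf_less_than wf)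
    show "\<And>x z. z \<in> B \<Longrightarrow> (x, z) \<in> inv_image (less_than <*lex*> (r - Id)) h \<Longrightarrow> x \<in> B"
      by (auto simp: h_def split: if_splits)
  qed
qed

lemma finite_has_maximum:
  assumes "total L" "trans L" "finite F" "F \<noteq> {}"
  shows "\<exists>y\<in>F. \<forall>z\<in>F. z = y \<or> (z, y) \<in> L"
  using assms(3,4)
proof (induction rule: finite_ne_induct)
  case (insert x F)
  then obtain y where y: "y \<in> F" "\<forall>z\<in>F. z = y \<or> (z, y) \<in> L" by blast
  show ?case
  proof (cases "(y, x) \<in> L")
    case True
    then have "\<forall>z\<in>insert x F. z = x \<or> (z, x) \<in> L"
      using y by (metis insert_iff transD[OF assms(2)])
    then show ?thesis by blast
  next
    case False
    then have "x = y \<or> (x, y) \<in> L"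
      using assms(1) unfolding total_on_def by blast
    then show ?thesis using y by blast
  qed
qed auto

context comm_group
begin

lemma coherent_empty: "coherent G s {}"
  using group.generate_empty[OF DirProd_group[OF is_group group_circle]]
  by (auto simp: coherent_def graph_gen_def)

text \<open>A violation of coherence involves finitely many elements only, and these lie in the
  closed initial segment of the largest of them.\<close>

lemma coherent_initial_segments:
  assumes L: "total L" "trans L" and A: "A \<subseteq> carrier G"
    and *: "\<And>y. y \<in> A \<Longrightarrow> coherent G s (insert y {z \<in> carrier G. (z, y) \<in> L})"
  shows "coherent G s A"
  unfolding coherent_def
proof (intro allI impI)
  fix w assume "(\<one>, w) \<in> graph_gen G s A"
  then obtain F where F: "finite F" "F \<subseteq> A" "(\<one>, w) \<in> graph_gen G s F"
    by (rule graph_gen_finite_support)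
  have "coherent G s F"
  proof (cases "F = {}")
    case False
    then obtain y where y: "y \<in> F" "\<forall>z\<in>F. z = y \<or> (z, y) \<in> L"
      using finite_has_maximum[OF L F(1)] by blast
    then show ?thesis
      using coherent_mono[OF *[of y]] F A by blast
  qed (simp add: coherent_empty)
  then show "w = 1"
    using F by (simp add: coherent_def)
qed

lemma generate_imp_graph_gen:
  assumes "g \<in> generate G B" "B \<subseteq> carrier G" "s \<in> B \<rightarrow> sphere 0 1"
  obtains w where "(g, w) \<in> graph_gen G s B"
proof -
  interpret S: subgroup "graph_gen G s B" "G \<times>\<times> circle_group"
    by (rule subgroup_graph_gen[OF assms(2,3)])
  have i: "(b, s b) \<in> graph_gen G s B" if "b \<in> B" for b
    using that unfolding graph_gen_def by (intro generate.incl) auto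
  from assms(1) have "\<exists>w. (g, w) \<in> graph_gen G s B"
  proof (induction rule: generate.induct)
    case one then show ?case using S.one_closed by auto
  next
    case (incl h) then show ?case using i by blast
  next
    case (inv h)
    then have "inv\<^bsub>G \<times>\<times> circle_group\<^esub> (h, s h) \<in> graph_gen G s B"
      by (intro S.m_inv_closed i)
    moreover have "h \<in> carrier G" "s h \<in> carrier circle_group" using inv assms by auto
    ultimately show ?case
      unfolding inv_DirProd[OF is_group group_circle \<open>h \<in> carrier G\<close> \<open>s h \<in> carrier circle_group\<close>] by blast
  next
    case (eng h1 h2)
    then obtain w1 w2 where "(h1, w1) \<in> graph_gen G s B" "(h2, w2) \<in> graph_gen G s B" by blast
    then have "(h1, w1) \<otimes>\<^bsub>G \<times>\<times> circle_group\<^esub> (h2, w2) \<in> graph_gen G s B" by (rule S.m_closed)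
    then show ?case by auto
  qed
  then show ?thesis using that by blast
qed

lemma graph_gen_imp_generate:
  assumes "(g, w) \<in> graph_gen G s B" "B \<subseteq> carrier G" "s \<in> B \<rightarrow> sphere 0 1"
  shows "g \<in> generate G B"
proof -
  have "fst p \<in> generate G B" if "p \<in> generate (G \<times>\<times> circle_group) ((\<lambda>b. (b, s b)) ` B)" for p
    using that
  proof (induction rule: generate.induct)
    case (inv h)
    then obtain b where b: "h = (b, s b)" "b \<in> B" by auto
    then have "b \<in> carrier G" "s b \<in> carrier circle_group" using assms by auto
    then show ?case using b by (auto simp: inv_DirProd[OF is_group group_circle] intro: generate.inv)
  qed (auto simp: mult_DirProd' intro: generate.intros)
  then show ?thesis using assms(1) unfolding graph_gen_def by fastforce
qed

text \<open>A character is built by transfinite recursion along a well-order in which \<open>B\<close> comes first; at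
  stage \<open>x\<close> the value \<open>d x\<close> is adopted whenever it is compatible with the values chosen so far.
  Whether it is compatible depends on countably many earlier elements only, so that closing a countable set
  under these dependencies yields a set on which the advice of a character is followed literally.\<close>

lemma character_recursion:
  assumes B: "B \<subseteq> carrier G"
  obtains s :: "('a \<Rightarrow> complex) \<Rightarrow> 'a \<Rightarrow> complex" where
    "\<And>d. d \<in> carrier G \<rightarrow> sphere 0 1 \<Longrightarrow> coherent G d B \<Longrightarrow> s d \<in> hom G circle_group"
    "\<And>d b. d \<in> carrier G \<rightarrow> sphere 0 1 \<Longrightarrow> coherent G d B \<Longrightarrow> b \<in> B \<Longrightarrow> s d b = d b"
    "\<And>N. countable N \<Longrightarrow> N \<subseteq> carrier G \<Longrightarrow> \<exists>C. countable C \<and> N \<subseteq> C \<and> C \<subseteq> carrier G \<and>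
       (\<forall>d f. d \<in> carrier G \<rightarrow> sphere 0 1 \<longrightarrow> coherent G d B \<longrightarrow> f \<in> hom G circle_group \<longrightarrow>
         (\<forall>x\<in>C. d x = f x) \<longrightarrow> (\<forall>x\<in>C. s d x = f x))"
proof -
  obtain L :: "'a rel" where L: "wf L" "trans L" "total L"
    and init: "\<And>x z. z \<in> B \<Longrightarrow> (x, z) \<in> L \<Longrightarrow> x \<in> B"
    using initial_wf_order[of B] by blast
  define Bel where "Bel x = {z \<in> carrier G. (z, x) \<in> L}" for x
  have Belc: "Bel x \<subseteq> carrier G" for x by (auto simp: Bel_def)
  have notBel: "x \<notin> Bel x" for x using L(1) by (auto simp: Bel_def)
  define ok where "ok h x v \<longleftrightarrow> v \<in> sphere 0 1 \<and> coherent G (h(x := v)) (insert x (Bel x))" for h x v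
  \<comment> \<open>When the advice clashes with earlier values, any admissible value is taken;
    \<open>main\<close> shows that one exists.\<close>
  define step where "step d h x = (if ok h x (d x) then d x else (SOME v. ok h x v))" for d h x
  define s where "s d = wfrec L (step d)" for d
  \<comment> \<open>Admissibility at \<open>x\<close> looks only at values below \<open>x\<close>,
    so the truncation \<open>cut\<close> made by \<open>wfrec\<close> has no effect.\<close>
  have okcong: "ok h x = ok h' x" if "\<And>z. (z, x) \<in> L \<Longrightarrow> h z = h' z" for h h' x
  proof
    fix v
    have "coherent G (h(x := v)) (insert x (Bel x)) = coherent G (h'(x := v)) (insert x (Bel x))"
      by (rule coherent_cong) (use that in \<open>auto simp: Bel_def\<close>)
    then show "ok h x v = ok h' x v" by (simp add: ok_def)
  qed
  have s_eq: "s d x = step d (s d) x" for d x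
  proof -
    have "s d x = step d (cut (s d) L x) x"
      unfolding s_def by (subst wfrec[OF L(1)]) simp
    also have "\<dots> = step d (s d) x"
    proof -
      have "ok (cut (s d) L x) x = ok (s d) x"
        by (rule okcong) (simp add: cut_apply)
      then show ?thesis by (simp add: step_def)
    qed
    finally show ?thesis .
  qed
  have main: "ok (s d) x (s d x)" if "x \<in> carrier G" for d x
    using that
  proof (induction x rule: wf_induct_rule[OF L(1)])
    case (1 x)
    have IH: "coherent G (s d) (insert y (Bel y))" "s d y \<in> sphere 0 1" if "y \<in> Bel x" for y
      using 1(1)[of y] that unfolding ok_def Bel_def by auto
    have c: "coherent G (s d) (Bel x)"
      by (rule coherent_initial_segments[OF L(3,2)]) (use IH in \<open>auto simp: Bel_def\<close>)
    have sp: "s d \<in> Bel x \<rightarrow> sphere 0 1" using IH by auto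
    obtain v where "v \<in> sphere 0 1" "\<And>n w. (x [^] (n::int), w) \<in> graph_gen G (s d) (Bel x) \<Longrightarrow> w = v powi n"
      using single_valued_extension[OF subgroup_graph_gen[OF Belc sp] _ 1(2)] c
      unfolding coherent_def by metis
    then have "ok (s d) x v"
      unfolding ok_def using coherent_insert[OF Belc sp 1(2) notBel c] by blast
    then show ?case
      using s_eq[of d x] someI[of "ok (s d) x" v] by (auto simp: step_def)
  qed
  have sp: "s d x \<in> sphere 0 1" and co: "coherent G (s d) (insert x (Bel x))" if "x \<in> carrier G" for d x
    using main[OF that, of d] by (auto simp: ok_def)
  have follow: "s d x = d x" if "ok (s d) x (d x)" for d x
    using s_eq[of d x] that by (simp add: step_def)
  have hom: "s d \<in> hom G circle_group" for d
  proof (rule coherent_carrier_imp_hom)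
    show "coherent G (s d) (carrier G)"
      by (rule coherent_initial_segments[OF L(3,2)]) (use co in \<open>auto simp: Bel_def\<close>)
  qed (use sp in auto)
  \<comment> \<open>Everything below a member of \<open>B\<close> is in \<open>B\<close>, where
    inductively \<open>d\<close> has been followed; coherence of \<open>d\<close> on
    \<open>B\<close> then makes the next advice admissible.\<close>
  have base: "s d b = d b" if d: "d \<in> carrier G \<rightarrow> sphere 0 1" "coherent G d B" and "b \<in> B" for d b
    using that(3)
  proof (induction b rule: wf_induct_rule[OF L(1)])
    case (1 x)
    have "coherent G ((s d)(x := d x)) (insert x (Bel x)) = coherent G d (insert x (Bel x))"
      by (rule coherent_cong) (use 1 init in \<open>auto simp: Bel_def\<close>)
    moreover have "insert x (Bel x) \<subseteq> B"
      using 1 init by (auto simp: Bel_def)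
    ultimately have "ok (s d) x (d x)"
      unfolding ok_def using coherent_mono[OF d(2)] d(1) 1(2) B by auto
    then show ?case by (rule follow)
  qed
  \<comment> \<open>A constraint on the value at \<open>x\<close> arises for each exponent
    \<open>n\<close> such that \<open>x [^] n\<close> is generated by earlier elements. The finite
    set \<open>dep x n\<close> already generates this power, so the constraint can be computed from
    the values on it. Without a constraint the set is empty.\<close>
  define dep where "dep x n = (if x [^] (n::int) \<in> generate G (Bel x)
      then (SOME F. finite F \<and> F \<subseteq> Bel x \<and> x [^] n \<in> generate G F) else {})" for x n
  have dep: "finite (dep x n) \<and> dep x n \<subseteq> Bel x \<and> x [^] n \<in> generate G (dep x n)"
    if "x [^] (n::int) \<in> generate G (Bel x)" for x n
  proof -
    have "\<exists>F. finite F \<and> F \<subseteq> Bel x \<and> x [^] n \<in> generate G F"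
      using generate_finite_support[OF that] by metis
    from someI_ex[OF this] show ?thesis using that by (simp add: dep_def)
  qed
  have dep_sub: "dep x n \<subseteq> Bel x" and dep_fin: "finite (dep x n)" for x n
    using dep[of x n] by (cases "x [^] n \<in> generate G (Bel x)"; simp add: dep_def)+
  have closure: "\<exists>C. countable C \<and> N \<subseteq> C \<and> C \<subseteq> carrier G \<and>
       (\<forall>d f. d \<in> carrier G \<rightarrow> sphere 0 1 \<longrightarrow> coherent G d B \<longrightarrow> f \<in> hom G circle_group \<longrightarrow>
         (\<forall>x\<in>C. d x = f x) \<longrightarrow> (\<forall>x\<in>C. s d x = f x))" if N: "countable N" "N \<subseteq> carrier G" for N
  proof -
    \<comment> \<open>The closure of \<open>N\<close> under \<open>dep\<close> takes countably many
      rounds, each adding only countably many elements.\<close>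
    define D where "D k = ((\<lambda>A. \<Union>x\<in>A. \<Union>n. dep x n) ^^ k) N" for k
    define C where "C = (\<Union>k. D k)"
    have Dk: "countable (D k) \<and> D k \<subseteq> carrier G" for k
    proof (induction k)
      case (Suc k)
      have "D (Suc k) = (\<Union>x\<in>D k. \<Union>n. dep x n)" by (simp add: D_def)
      moreover have "countable (\<Union>x\<in>D k. \<Union>n. dep x n)"
        using Suc by (intro countable_UN) (auto intro: countable_finite dep_fin)
      moreover have "(\<Union>x\<in>D k. \<Union>n. dep x n) \<subseteq> carrier G"
        using dep_sub Belc by (intro UN_least) (rule order_trans)
      ultimately show ?case by simp
    qed (use N in \<open>auto simp: D_def\<close>)
    have Csub: "countable C" "C \<subseteq> carrier G"
      unfolding C_def using Dk by auto
    have NC: "N \<subseteq> C"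
      unfolding C_def D_def by (rule order_trans[OF _ UN_upper[of 0]]) auto
    have Cdep: "dep x n \<subseteq> C" if xC: "x \<in> C" for x n
    proof -
      obtain k where "x \<in> D k" using xC by (auto simp: C_def)
      then have "dep x n \<subseteq> D (Suc k)" by (auto simp: D_def)
      then show ?thesis by (auto simp: C_def)
    qed
    have fol: "s d x = f x" if d: "d \<in> carrier G \<rightarrow> sphere 0 1" "coherent G d B" and f: "f \<in> hom G circle_group"
      and df: "\<forall>x\<in>C. d x = f x" and "x \<in> C" for d f x
      using that(5)
    proof (induction x rule: wf_induct_rule[OF L(1)])
      case (1 x)
      interpret H: group_hom G circle_group f
        by (intro group_hom.intro group_hom_axioms.intro is_group group_circle f)
      have x: "x \<in> carrier G" using 1 Csub by auto
      have sB: "s d \<in> Bel x \<rightarrow> sphere 0 1" using sp Belc[of x] by auto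
      have c: "coherent G (s d) (Bel x)"
        using co[OF x] by (rule coherent_mono) auto
      interpret S: subgroup "graph_gen G (s d) (Bel x)" "G \<times>\<times> circle_group"
        by (rule subgroup_graph_gen[OF Belc sB])
      have "coherent G ((s d)(x := d x)) (insert x (Bel x))"
      proof (rule coherent_insert[OF Belc sB x notBel c])
        show "d x \<in> sphere 0 1" using d x by auto
        fix n :: int and w assume w: "(x [^] n, w) \<in> graph_gen G (s d) (Bel x)"
        then have g: "x [^] n \<in> generate G (Bel x)"
          by (rule graph_gen_imp_generate) (use Belc sB in auto)
        have sdep: "s d \<in> dep x n \<rightarrow> sphere 0 1" "dep x n \<subseteq> carrier G"
          using sB dep_sub[of x n] Belc[of x] by auto
        then obtain w' where w': "(x [^] n, w') \<in> graph_gen G (s d) (dep x n)"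
          using generate_imp_graph_gen[of "x [^] n" "dep x n" "s d"] dep[OF g] by metis
        \<comment> \<open>On \<open>dep x n\<close>, a subset of \<open>C\<close> below
          \<open>x\<close>, the induction hypothesis says that the constructed character equals
          \<open>f\<close>.\<close>
        have "w' = f (x [^] n)"
        proof (rule graph_gen_hom[OF sdep(2) f _ w'])
          fix b assume "b \<in> dep x n"
          then show "s d b = f b"
            using 1 Cdep[of x n] dep_sub[of x n] by (auto simp: Bel_def)
        qed
        also have "\<dots> = d x powi n"
        proof -
          have "f x \<in> sphere 0 1" using H.hom_closed[OF x] by simp
          then show ?thesis using H.hom_int_pow[OF x] df 1(2) by (simp add: int_pow_circle)
        qed
        finally have w'v: "w' = d x powi n" .
        have w'B: "(x [^] n, w') \<in> graph_gen G (s d) (Bel x)"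
          using w' graph_gen_mono[OF dep_sub] by blast
        \<comment> \<open>Both \<open>w\<close> and \<open>w'\<close> lie over
          \<open>x [^] n\<close> in a single-valued subgroup, so the constraint from all earlier
          elements is the one already computed from \<open>dep x n\<close>.\<close>
        have "(x [^] n, w) \<otimes>\<^bsub>G \<times>\<times> circle_group\<^esub> inv\<^bsub>G \<times>\<times> circle_group\<^esub> (x [^] n, w') \<in> graph_gen G (s d) (Bel x)"
          by (intro S.m_closed S.m_inv_closed w w'B)
        moreover have wc: "w' \<in> sphere 0 1"
          using S.mem_carrier[OF w'B] by simp
        ultimately have "(\<one>, w * inverse w') \<in> graph_gen G (s d) (Bel x)"
          using x by (simp add: inv_DirProd[OF is_group group_circle] inv_circle)
        then have "w * inverse w' = 1"
          using c by (simp add: coherent_def)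
        then show "w = d x powi n"
          using w'v wc by (auto simp: field_simps)
      qed
      then have "ok (s d) x (d x)"
        using d x by (auto simp: ok_def)
      then show ?case using follow df 1(2) by simp
    qed
    show ?thesis
      by (intro exI[of _ C] conjI allI impI ballI Csub NC) (rule fol)
  qed
  show ?thesis
    by (rule that[of s]) (rule hom, fact base, fact closure)
qed

text \<open>This is the injectivity of the circle, obtained from the recursion with the constant
  advice 1 off \<open>B\<close>.\<close>

lemma character_extension:
  assumes B: "B \<subseteq> carrier G" and d: "d \<in> B \<rightarrow> sphere 0 1" and c: "coherent G d B"
  obtains f where "f \<in> hom G circle_group" "\<And>b. b \<in> B \<Longrightarrow> f b = d b"
proof -
  obtain s where s: "\<And>d. d \<in> carrier G \<rightarrow> sphere 0 1 \<Longrightarrow> coherent G d B \<Longrightarrow> s d \<in> hom G circle_group"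
    "\<And>d b. d \<in> carrier G \<rightarrow> sphere 0 1 \<Longrightarrow> coherent G d B \<Longrightarrow> b \<in> B \<Longrightarrow> s d b = d b"
    using character_recursion[OF B] by metis
  define e where "e x = (if x \<in> B then d x else 1)" for x
  have "e \<in> carrier G \<rightarrow> sphere 0 1" "coherent G e B"
    using d c coherent_cong[of B e d G] by (auto simp: e_def)
  from s(1)[OF this] s(2)[OF this] show ?thesis
    by (intro that[of "s e"]) (auto simp: e_def)
qed

end

section \<open>Interpolation matrices\<close>

abbreviation seqs :: "'k set \<Rightarrow> (nat \<Rightarrow> 'k) set" where
  "seqs K \<equiv> Pi UNIV (\<lambda>_. K)"

lemma nat_sets_lepoll_seqs:
  assumes "infinite K"
  shows "(UNIV :: nat set set) \<lesssim> seqs K"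
proof -
  obtain x y where xy: "x \<in> K" "y \<in> K" "x \<noteq> y"
    using assms by (metis finite.emptyI finite.insertI finite_subset singletonI subsetI)
  show ?thesis
    unfolding lepoll_def
  proof (intro exI conjI)
    show "inj_on (\<lambda>A n. if n \<in> A then x else y) UNIV"
      using xy by (auto simp: inj_on_def fun_eq_iff split: if_splits)
    show "(\<lambda>A n. if n \<in> A then x else y) ` UNIV \<subseteq> seqs K"
      using xy by auto
  qed
qed

lemma seqs_times_seqs_lepoll: "seqs K \<times> seqs K \<lesssim> seqs K"
  unfolding lepoll_def
proof (intro exI conjI)
  let ?f = "\<lambda>p (n::nat). if even n then fst p (n div 2) else snd p (n div 2)"
  show "inj_on ?f (seqs K \<times> seqs K)"
  proof (rule inj_onI)
    fix p q assume e: "?f p = ?f q"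
    have "fst p n = fst q n" for n
      using fun_cong[OF e, of "2 * n"] by simp
    moreover have "snd p n = snd q n" for n
      using fun_cong[OF e, of "Suc (2 * n)"] by simp
    ultimately show "p = q" by (simp add: prod_eq_iff fun_eq_iff)
  qed
  show "?f ` (seqs K \<times> seqs K) \<subseteq> seqs K"
    by (auto simp: Pi_iff)
qed

lemma nat_set_seqs_lepoll: "(UNIV :: (nat \<Rightarrow> nat set) set) \<lesssim> (UNIV :: nat set set)"
  unfolding lepoll_def
proof (intro exI conjI)
  show "inj_on (\<lambda>f. {prod_encode (n, m) |n m. m \<in> f n}) (UNIV :: (nat \<Rightarrow> nat set) set)"
  proof (rule inj_onI)
    fix f g :: "nat \<Rightarrow> nat set"
    assume e: "{prod_encode (n, m) |n m. m \<in> f n} = {prod_encode (n, m) |n m. m \<in> g n}"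
    have "m \<in> f n \<longleftrightarrow> m \<in> g n" for n m
    proof -
      have "m \<in> f n \<longleftrightarrow> prod_encode (n, m) \<in> {prod_encode (n, m) |n m. m \<in> f n}" by auto
      also have "\<dots> \<longleftrightarrow> m \<in> g n" unfolding e by auto
      finally show ?thesis .
    qed
    then show "f = g" by blast
  qed
qed auto

text \<open>A sequence of complex numbers is determined by the rational lower cuts of the real and
  imaginary parts, and all these cuts together form one subset of a countable type.\<close>

lemma complex_seqs_lepoll: "(UNIV :: (nat \<Rightarrow> complex) set) \<lesssim> (UNIV :: nat set set)"
  unfolding lepoll_def
proof (intro exI conjI)
  let ?h = "\<lambda>v. {to_nat (n, b, q) |n b q. real_of_rat q < (if b then Re (v n) else Im (v n))}"
  show "inj_on ?h (UNIV :: (nat \<Rightarrow> complex) set)"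
  proof (rule inj_onI)
    fix v w :: "nat \<Rightarrow> complex" assume e: "?h v = ?h w"
    have q: "real_of_rat q < (if b then Re (v n) else Im (v n)) \<longleftrightarrow> real_of_rat q < (if b then Re (w n) else Im (w n))" for n b q
    proof -
      have "real_of_rat q < (if b then Re (v n) else Im (v n)) \<longleftrightarrow> to_nat (n, b, q) \<in> ?h v" by auto
      also have "\<dots> \<longleftrightarrow> real_of_rat q < (if b then Re (w n) else Im (w n))" unfolding e by auto
      finally show ?thesis .
    qed
    have r: "x = y" if "\<And>q. real_of_rat q < x \<longleftrightarrow> real_of_rat q < y" for x y
      using that of_rat_dense[of x y] of_rat_dense[of y x] by (metis linorder_neqE_linordered_idom less_asym)
    have "v n = w n" for n
    proof (rule complex_eqI)
      show "Re (v n) = Re (w n)" using r q[of _ True n] by auto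
      show "Im (v n) = Im (w n)" using r q[of _ False n] by auto
    qed
    then show "v = w" by blast
  qed
qed auto

lemma lepoll_surjection:
  fixes A :: "'a set" and B :: "'b set"
  assumes "A \<lesssim> B" "A \<noteq> {}"
  obtains g where "g ` B = A"
proof -
  obtain g where g: "A \<subseteq> g ` B" using assms by (auto simp: lepoll_iff)
  obtain a where "a \<in> A" using assms by blast
  then have "(\<lambda>b. if g b \<in> A then g b else a) ` B = A"
    using g by (auto simp: image_iff)
  then show ?thesis by (rule that)
qed

lemma infinite_times_lepoll:
  fixes Z :: "'x set" and A :: "'a set" and B :: "'b set"
  assumes "infinite Z" "A \<lesssim> Z" "B \<lesssim> Z"
  shows "(A \<times> B) \<lesssim> Z"
proof -
  have "(A \<times> B) \<lesssim> (Z \<times> Z)" using assms by (intro times_lepoll_mono)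
  also have "Z \<times> Z \<approx> Z"
    unfolding eqpoll_iff_card_of_ordIso by (rule card_of_Times_same_infinite) fact
  finally show ?thesis .
qed

text \<open>Codes are countable data, so there are only \<open>\<kappa>\<^sup>\<omega>\<close> of them, and still they realise every countable
  prescription: countably many subsets \<open>\<phi>\<close> of \<open>K\<close> are told apart by their traces along a sequence \<open>k\<close>.\<close>

definition decode :: "(nat \<Rightarrow> 'k) \<times> (nat \<Rightarrow> nat set) \<times> (nat \<Rightarrow> nat set) \<times> (nat \<Rightarrow> complex) \<Rightarrow>
    nat set \<times> 'k set \<Rightarrow> complex" where
  "decode = (\<lambda>(k, a, b, v) (\<rho>, \<phi>).
     if \<exists>n. \<rho> = a n \<and> {i. k i \<in> \<phi>} = b n then v (LEAST n. \<rho> = a n \<and> {i. k i \<in> \<phi>} = b n) else 1)"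

text \<open>The first coordinate \<rho> of a position is there for the last claim: a code differs
  from 1 over countably many \<rho> only, so that two codes can later be multiplied without
  disturbing each other at a well-chosen \<rho>.\<close>

lemma codes_exist:
  fixes K :: "'k set" and V :: "complex set"
  assumes K: "infinite K" and V: "1 \<in> V"
  obtains Cod :: "(nat set \<times> 'k set \<Rightarrow> complex) set" where
    "Cod \<lesssim> seqs K" "Cod \<noteq> {}"
    "\<And>c p. c \<in> Cod \<Longrightarrow> c p \<in> V"
    "\<And>\<Psi> t. countable \<Psi> \<Longrightarrow> \<Psi> \<subseteq> UNIV \<times> Pow K \<Longrightarrow> t \<in> \<Psi> \<rightarrow> V \<Longrightarrow> \<exists>c\<in>Cod. \<forall>p\<in>\<Psi>. c p = t p"
    "\<And>c. c \<in> Cod \<Longrightarrow> countable {\<rho>. \<exists>\<phi>. c (\<rho>, \<phi>) \<noteq> 1}"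
proof -
  define P where "P = seqs K \<times> (UNIV :: (nat \<Rightarrow> nat set) set) \<times> (UNIV :: (nat \<Rightarrow> nat set) set) \<times> seqs V"
  \<comment> \<open>Apart from \<open>seqs K\<close> itself, every factor has at most continuum many
    elements, and the continuum embeds into \<open>seqs K\<close> because \<open>K\<close> is
    infinite.\<close>
  have "P \<lesssim> seqs K \<times> seqs K \<times> seqs K \<times> seqs K"
    unfolding P_def
    by (intro times_lepoll_mono lepoll_refl lepoll_trans[OF nat_set_seqs_lepoll nat_sets_lepoll_seqs[OF K]]
        lepoll_trans[OF subset_imp_lepoll[OF subset_UNIV] lepoll_trans[OF complex_seqs_lepoll nat_sets_lepoll_seqs[OF K]]])
  also have "\<dots> \<lesssim> seqs K \<times> seqs K \<times> seqs K"
    by (intro times_lepoll_mono lepoll_refl seqs_times_seqs_lepoll)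
  also have "\<dots> \<lesssim> seqs K \<times> seqs K"
    by (intro times_lepoll_mono lepoll_refl seqs_times_seqs_lepoll)
  also have "\<dots> \<lesssim> seqs K"
    by (rule seqs_times_seqs_lepoll)
  finally have P: "P \<lesssim> seqs K" .
  obtain k0 where k0: "k0 \<in> K" using K by (metis ex_in_conv finite.emptyI)
  have Pne: "((\<lambda>_. k0), (\<lambda>_. {}), (\<lambda>_. {}), (\<lambda>_. 1)) \<in> P"
    using V k0 by (auto simp: P_def)
  show ?thesis
  proof (rule that[of "decode ` P"])
    show "decode ` P \<lesssim> seqs K"
      using image_lepoll P by (rule lepoll_trans)
    show "decode ` P \<noteq> {}" using Pne by blast
    show "\<And>c p. c \<in> decode ` P \<Longrightarrow> c p \<in> V"
      using V by (auto simp: P_def decode_def)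
  next
    fix c assume "c \<in> decode ` P"
    then obtain k a b v where "c = decode (k, a, b, v)" by (auto simp: P_def)
    then have "{\<rho>. \<exists>\<phi>. c (\<rho>, \<phi>) \<noteq> 1} \<subseteq> range a"
      by (auto simp: decode_def split: if_splits)
    then show "countable {\<rho>. \<exists>\<phi>. c (\<rho>, \<phi>) \<noteq> 1}"
      by (rule countable_subset) auto
  next
    fix \<Psi> :: "(nat set \<times> 'k set) set" and t
    assume \<Psi>: "countable \<Psi>" "\<Psi> \<subseteq> UNIV \<times> Pow K" "t \<in> \<Psi> \<rightarrow> V"
    show "\<exists>c\<in>decode ` P. \<forall>p\<in>\<Psi>. c p = t p"
    proof (cases "\<Psi> = {}")
      case True
      then show ?thesis using Pne by blast
    next
      case False
      define p where "p = from_nat_into \<Psi>"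
      have p: "range p = \<Psi>" unfolding p_def using range_from_nat_into[OF False \<Psi>(1)] .
      define sep where "sep A C = (SOME i. i \<in> K \<and> (i \<in> A \<longleftrightarrow> i \<notin> C))" for A C :: "'k set"
      have sep: "sep A C \<in> K \<and> (sep A C \<in> A \<longleftrightarrow> sep A C \<notin> C)" if "A \<subseteq> K" "C \<subseteq> K" "A \<noteq> C" for A C
        unfolding sep_def by (rule someI_ex) (use that in blast)
      \<comment> \<open>The sequence visits a separating point for every pair of indices, so
        distinct second components among the \<open>p n\<close> get distinct traces.\<close>
      define k where "k i = (let A = snd (p (fst (prod_decode i))); C = snd (p (snd (prod_decode i)))
        in if A \<noteq> C then sep A C else k0)" for i
      have pK: "snd (p n) \<subseteq> K" for n
      proof -
        have "p n \<in> UNIV \<times> Pow K" using p \<Psi>(2) by blast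
        then show ?thesis by (simp add: mem_Times_iff)
      qed
      have "k i \<in> K" for i
        unfolding k_def Let_def by (simp add: k0 sep[OF pK pK])
      then have kK: "k \<in> seqs K" by simp
      have ksep: "snd (p n) = snd (p m)" if e: "{i. k i \<in> snd (p n)} = {i. k i \<in> snd (p m)}" for n m
      proof (rule ccontr)
        assume ne: "snd (p n) \<noteq> snd (p m)"
        then have "k (prod_encode (n, m)) = sep (snd (p n)) (snd (p m))" by (simp add: k_def)
        then have "k (prod_encode (n, m)) \<in> snd (p n) \<longleftrightarrow> k (prod_encode (n, m)) \<notin> snd (p m)"
          using sep[OF pK pK ne] by simp
        then show False using e by blast
      qed
      define a where "a = fst \<circ> p"
      define b where "b n = {i. k i \<in> snd (p n)}" for n
      define v where "v = t \<circ> p"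
      have "v \<in> seqs V" using p \<Psi>(3) by (auto simp: v_def)
      then have "(k, a, b, v) \<in> P" using kK by (simp add: P_def)
      moreover have "decode (k, a, b, v) q = t q" if "q \<in> \<Psi>" for q
      proof -
        obtain m where m: "q = p m" using \<open>q \<in> \<Psi>\<close> p by blast
        \<comment> \<open>The enumeration \<open>p\<close> may repeat positions, so several indices
          can satisfy \<open>Q\<close>. All of them name the position \<open>q\<close> itself, and
          hence the least one returns \<open>t q\<close>.\<close>
        define Q where "Q n \<longleftrightarrow> fst q = a n \<and> {i. k i \<in> snd q} = b n" for n
        have Qm: "Q m" by (simp add: m a_def b_def Q_def)
        define l where "l = (LEAST n. Q n)"
        have l: "Q l" unfolding l_def using Qm by (rule LeastI)
        have "snd (p m) = snd (p l)"
          using l by (intro ksep) (auto simp: m b_def Q_def)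
        moreover have "fst (p m) = fst (p l)" using l by (simp add: m a_def Q_def)
        ultimately have "p m = p l" by (simp add: prod_eq_iff)
        then have "v l = t q" by (simp add: v_def m)
        moreover have "decode (k, a, b, v) q = v l"
          using Qm by (cases q) (auto simp: decode_def Q_def l_def)
        ultimately show ?thesis by simp
      qed
      ultimately show ?thesis by blast
    qed
  qed
qed

text \<open>Both \<open>\<sigma> x (\<rho>' y, \<iota>' y)\<close> and \<open>\<sigma>' y (\<rho> x, \<iota> x)\<close> alone would take care of one of the two
  interpolation properties. Their product has both: only countably many values of \<open>\<rho> x\<close> disturb a given countable set of
  columns, and every code \<open>\<sigma> x\<close> occurs with uncountably many values of \<open>\<rho> x\<close>.\<close>

lemma interpolation_matrix:
  fixes K :: "'k set" and Z :: "'x set" and Y :: "'y set" and S :: "'s set" and V :: "complex set"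
  assumes K: "infinite K" and V: "1 \<in> V" "\<And>u v. u \<in> V \<Longrightarrow> v \<in> V \<Longrightarrow> u * v \<in> V"
    and Z: "seqs K \<lesssim> Z" "Z \<lesssim> Pow K" and Y: "seqs K \<lesssim> Y" "Y \<lesssim> Pow K"
    and S: "S \<lesssim> Y" "S \<noteq> {}"
  obtains M :: "'x \<Rightarrow> 'y \<Rightarrow> complex" and \<delta> :: "'y \<Rightarrow> 's" where
    "\<And>x y. x \<in> Z \<Longrightarrow> y \<in> Y \<Longrightarrow> M x y \<in> V" "\<And>y. y \<in> Y \<Longrightarrow> \<delta> y \<in> S"
    "\<And>B t. countable B \<Longrightarrow> B \<subseteq> Y \<Longrightarrow> t \<in> B \<rightarrow> V \<Longrightarrow> \<exists>x\<in>Z. \<forall>y\<in>B. M x y = t y"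
    "\<And>C t s. countable C \<Longrightarrow> C \<subseteq> Z \<Longrightarrow> t \<in> C \<rightarrow> V \<Longrightarrow> s \<in> S \<Longrightarrow>
       \<exists>y\<in>Y. \<delta> y = s \<and> (\<forall>x\<in>C. M x y = t x)"
proof -
  obtain Cod :: "(nat set \<times> 'k set \<Rightarrow> complex) set" where Cod: "Cod \<lesssim> seqs K" "Cod \<noteq> {}"
    "\<And>c p. c \<in> Cod \<Longrightarrow> c p \<in> V"
    "\<And>\<Psi> t. countable \<Psi> \<Longrightarrow> \<Psi> \<subseteq> UNIV \<times> Pow K \<Longrightarrow> t \<in> \<Psi> \<rightarrow> V \<Longrightarrow> \<exists>c\<in>Cod. \<forall>p\<in>\<Psi>. c p = t p"
    "\<And>c. c \<in> Cod \<Longrightarrow> countable {\<rho>. \<exists>\<phi>. c (\<rho>, \<phi>) \<noteq> 1}"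
    by (rule codes_exist[OF K V(1)]) (rule that; (assumption | meson))
  have natZ: "(UNIV :: nat set set) \<lesssim> Z" and natY: "(UNIV :: nat set set) \<lesssim> Y"
    using nat_sets_lepoll_seqs[OF K] Z Y lepoll_trans by blast+
  \<comment> \<open>Uncountability leaves room to pick a value of \<rho> outside a countable set of
    bad ones.\<close>
  have unc: "uncountable (UNIV :: nat set set)"
  proof
    assume "countable (UNIV :: nat set set)"
    then have "(UNIV :: nat set set) \<lesssim> (UNIV :: nat set)"
      by (auto simp: countable_def lepoll_def)
    then show False
      using lesspoll_Pow_self[of "UNIV :: nat set"] lesspoll_trans2 by fastforce
  qed
  have infZ: "infinite Z" and infY: "infinite Y"
    using natZ natY unc countable_lepoll countable_finite by blast+
  have "(UNIV :: nat set set) \<times> Cod \<lesssim> Z"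
    by (intro infinite_times_lepoll infZ natZ lepoll_trans[OF Cod(1) Z(1)])
  then obtain h where h: "h ` Z = (UNIV :: nat set set) \<times> Cod"
    by (rule lepoll_surjection) (use Cod(2) in auto)
  \<comment> \<open>The third component gives each column a label in \<open>S\<close>. Every
    combination of label and code occurs, so a column can be requested with both its label and its
    entries on a countable set prescribed.\<close>
  have "(UNIV :: nat set set) \<times> Cod \<times> S \<lesssim> Y"
    by (intro infinite_times_lepoll infY natY lepoll_trans[OF Cod(1) Y(1)] S(1))
  then obtain h' where h': "h' ` Y = (UNIV :: nat set set) \<times> Cod \<times> S"
    by (rule lepoll_surjection) (use Cod(2) S(2) in auto)
  \<comment> \<open>Subsets of \<open>K\<close> serve as names of rows and columns; codes can tell
    such names apart.\<close>
  obtain \<iota> where \<iota>: "inj_on \<iota> Z" "\<iota> ` Z \<subseteq> Pow K" using Z(2) by (auto simp: lepoll_def)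
  obtain \<iota>' where \<iota>': "inj_on \<iota>' Y" "\<iota>' ` Y \<subseteq> Pow K" using Y(2) by (auto simp: lepoll_def)
  define \<rho> \<sigma> where "\<rho> = fst \<circ> h" and "\<sigma> = snd \<circ> h"
  define \<rho>' \<sigma>' \<delta> where "\<rho>' = fst \<circ> h'" and "\<sigma>' = fst \<circ> snd \<circ> h'" and "\<delta> = snd \<circ> snd \<circ> h'"
  have \<sigma>: "\<sigma> x \<in> Cod" if "x \<in> Z" for x
    using h that unfolding \<sigma>_def by (metis comp_apply imageI mem_Times_iff)
  have \<sigma>': "\<sigma>' y \<in> Cod" "\<delta> y \<in> S" if "y \<in> Y" for y
    using h' that unfolding \<sigma>'_def \<delta>_def by (metis comp_apply imageI mem_Times_iff)+
  have sur: "\<exists>x\<in>Z. \<rho> x = r \<and> \<sigma> x = c" if "c \<in> Cod" for r c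
  proof -
    have "(r, c) \<in> h ` Z" using h that by auto
    then obtain x where "x \<in> Z" "h x = (r, c)" by (metis imageE)
    then show ?thesis unfolding \<rho>_def \<sigma>_def by (intro bexI[of _ x]) simp_all
  qed
  have sur': "\<exists>y\<in>Y. \<rho>' y = r \<and> \<sigma>' y = c \<and> \<delta> y = s" if "c \<in> Cod" "s \<in> S" for r c s
  proof -
    have "(r, c, s) \<in> h' ` Y" using h' that by auto
    then obtain y where "y \<in> Y" "h' y = (r, c, s)" by (metis imageE)
    then show ?thesis unfolding \<rho>'_def \<sigma>'_def \<delta>_def by (intro bexI[of _ y]) simp_all
  qed
  define M where "M x y = \<sigma> x (\<rho>' y, \<iota>' y) * \<sigma>' y (\<rho> x, \<iota> x)" for x y
  show ?thesis
  proof (rule that[of M \<delta>])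
    show "\<And>x y. x \<in> Z \<Longrightarrow> y \<in> Y \<Longrightarrow> M x y \<in> V"
      unfolding M_def by (intro V Cod(3) \<sigma> \<sigma>')
    show "\<And>y. y \<in> Y \<Longrightarrow> \<delta> y \<in> S" by (rule \<sigma>')
  next
    fix B t assume B: "countable B" "B \<subseteq> Y" "t \<in> B \<rightarrow> V"
    let ?e = "\<lambda>y. (\<rho>' y, \<iota>' y)"
    have inj: "inj_on ?e B" using \<iota>'(1) B(2) by (auto simp: inj_on_def)
    have "\<exists>c\<in>Cod. \<forall>p\<in>?e ` B. c p = (t \<circ> the_inv_into B ?e) p"
    proof (rule Cod(4))
      show "?e ` B \<subseteq> UNIV \<times> Pow K" using \<iota>'(2) B(2) by auto
      show "t \<circ> the_inv_into B ?e \<in> ?e ` B \<rightarrow> V"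
        using the_inv_into_f_f[OF inj] B(3) by auto
    qed (use B in auto)
    then obtain c where c: "c \<in> Cod" "\<And>y. y \<in> B \<Longrightarrow> c (\<rho>' y, \<iota>' y) = t y"
      using the_inv_into_f_f[OF inj] by auto
    have "countable (\<Union>y\<in>B. {r. \<exists>\<phi>. \<sigma>' y (r, \<phi>) \<noteq> 1})"
      using B by (intro countable_UN Cod(5) \<sigma>') auto
    then have "(\<Union>y\<in>B. {r. \<exists>\<phi>. \<sigma>' y (r, \<phi>) \<noteq> 1}) \<noteq> UNIV"
      using unc by auto
    then obtain r where r: "r \<notin> (\<Union>y\<in>B. {r. \<exists>\<phi>. \<sigma>' y (r, \<phi>) \<noteq> 1})"
      by blast
    obtain x where x: "x \<in> Z" "\<rho> x = r" "\<sigma> x = c" using sur[OF c(1)] by blast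
    have "M x y = t y" if "y \<in> B" for y
      unfolding M_def using x c(2)[OF that] r that by auto
    then show "\<exists>x\<in>Z. \<forall>y\<in>B. M x y = t y" using x by blast
  next
    fix C t s assume C: "countable C" "C \<subseteq> Z" "t \<in> C \<rightarrow> V" and s: "s \<in> S"
    let ?e = "\<lambda>x. (\<rho> x, \<iota> x)"
    have inj: "inj_on ?e C" using \<iota>(1) C(2) by (auto simp: inj_on_def)
    have "\<exists>c\<in>Cod. \<forall>p\<in>?e ` C. c p = (t \<circ> the_inv_into C ?e) p"
    proof (rule Cod(4))
      show "?e ` C \<subseteq> UNIV \<times> Pow K" using \<iota>(2) C(2) by auto
      show "t \<circ> the_inv_into C ?e \<in> ?e ` C \<rightarrow> V"
        using the_inv_into_f_f[OF inj] C(3) by auto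
    qed (use C in auto)
    then obtain c where c: "c \<in> Cod" "\<And>x. x \<in> C \<Longrightarrow> c (\<rho> x, \<iota> x) = t x"
      using the_inv_into_f_f[OF inj] by auto
    have "countable (\<Union>x\<in>C. {r. \<exists>\<phi>. \<sigma> x (r, \<phi>) \<noteq> 1})"
      using C by (intro countable_UN Cod(5) \<sigma>) auto
    then have "(\<Union>x\<in>C. {r. \<exists>\<phi>. \<sigma> x (r, \<phi>) \<noteq> 1}) \<noteq> UNIV"
      using unc by auto
    then obtain r where r: "r \<notin> (\<Union>x\<in>C. {r. \<exists>\<phi>. \<sigma> x (r, \<phi>) \<noteq> 1})"
      by blast
    obtain y where y: "y \<in> Y" "\<rho>' y = r" "\<sigma>' y = c" "\<delta> y = s" using sur'[OF c(1) s] by blast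
    have "M x y = t x" if "x \<in> C" for x
      unfolding M_def using y c(2)[OF that] r that by auto
    then show "\<exists>y\<in>Y. \<delta> y = s \<and> (\<forall>x\<in>C. M x y = t x)" using y by blast
  qed
qed

section \<open>Pseudocompact topologies from interpolating families\<close>

text \<open>Values are prescribed only within the range of each character, since on sums of copies
  of Z(q) the ranges are finite. Closed ranges make limits of attained values attainable again.
  Products of lists appear because a character of a direct product is a product of characters coming
  from the two factors.\<close>

definition interpolating :: "('a, 'b) monoid_scheme \<Rightarrow> ('a \<Rightarrow> complex) set \<Rightarrow> bool" where
  "interpolating G Y \<longleftrightarrow> Y \<subseteq> hom G circle_group \<and> (\<forall>y\<in>Y. closed (y ` carrier G)) \<and>
    (\<forall>B t. countable B \<and> B \<subseteq> Y \<and> (\<forall>y\<in>B. t y \<in> y ` carrier G) \<longrightarrow>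
      (\<exists>g\<in>carrier G. \<forall>y\<in>B. y g = t y)) \<and>
    (\<forall>N f. countable N \<and> N \<subseteq> carrier G \<and> f \<in> hom G circle_group \<longrightarrow>
      (\<exists>ys. set ys \<subseteq> Y \<and> (\<forall>x\<in>N. f x = (\<Prod>y\<leftarrow>ys. y x))))"

lemma interpolating_hom: "interpolating G Y \<Longrightarrow> y \<in> Y \<Longrightarrow> y \<in> hom G circle_group"
  unfolding interpolating_def by (elim conjE, erule subsetD, assumption)

lemma interpolating_closed: "interpolating G Y \<Longrightarrow> y \<in> Y \<Longrightarrow> closed (y ` carrier G)"
  unfolding interpolating_def by (elim conjE, drule bspec, assumption)

lemma interpolating_point:
  assumes "interpolating G Y" "countable B" "B \<subseteq> Y" "\<And>y. y \<in> B \<Longrightarrow> t y \<in> y ` carrier G"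
  obtains g where "g \<in> carrier G" "\<And>y. y \<in> B \<Longrightarrow> y g = t y"
proof -
  have "\<forall>B t. countable B \<and> B \<subseteq> Y \<and> (\<forall>y\<in>B. t y \<in> y ` carrier G) \<longrightarrow>
      (\<exists>g\<in>carrier G. \<forall>y\<in>B. y g = t y)"
    using assms(1) by (simp add: interpolating_def)
  from this[rule_format, of B t] assms(2-4) show ?thesis
    using that by auto
qed

lemma interpolating_character:
  assumes "interpolating G Y" "countable N" "N \<subseteq> carrier G" "f \<in> hom G circle_group"
  obtains ys where "set ys \<subseteq> Y" "\<And>x. x \<in> N \<Longrightarrow> f x = (\<Prod>y\<leftarrow>ys. y x)"
proof -
  have "\<forall>N f. countable N \<and> N \<subseteq> carrier G \<and> f \<in> hom G circle_group \<longrightarrow>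
      (\<exists>ys. set ys \<subseteq> Y \<and> (\<forall>x\<in>N. f x = (\<Prod>y\<leftarrow>ys. y x)))"
    using assms(1) by (simp add: interpolating_def)
  from this[rule_format, of N f] assms(2-4) show ?thesis
    using that by auto
qed

section \<open>The initial topology of a family of characters\<close>

definition character_topology :: "('a, 'b) monoid_scheme \<Rightarrow> ('a \<Rightarrow> complex) set \<Rightarrow> 'a topology" where
  "character_topology G Y =
     pullback_topology (carrier G) (\<lambda>g. \<lambda>y\<in>Y. y g) (product_topology (\<lambda>_. euclidean) Y)"

lemma topspace_character_topology [simp]: "topspace (character_topology G Y) = carrier G"
  by (auto simp: character_topology_def topspace_pullback_topology)

lemma continuous_map_character:
  assumes "y \<in> Y"
  shows "continuous_map (character_topology G Y) euclidean y"
proof -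
  have "continuous_map (character_topology G Y) euclidean ((\<lambda>f. f y) \<circ> (\<lambda>g. \<lambda>y\<in>Y. y g))"
    unfolding character_topology_def
    by (intro continuous_map_pullback continuous_map_product_projection assms)
  then show ?thesis
    by (rule continuous_map_eq) (use assms in auto)
qed

lemma continuous_map_into_character_topology:
  assumes "h \<in> topspace S \<rightarrow> carrier G" "\<And>y. y \<in> Y \<Longrightarrow> continuous_map S euclidean (\<lambda>x. y (h x))"
  shows "continuous_map S (character_topology G Y) h"
  unfolding character_topology_def
proof (rule continuous_map_pullback')
  show "continuous_map S (product_topology (\<lambda>_. euclidean) Y) ((\<lambda>g. \<lambda>y\<in>Y. y g) \<circ> h)"
    using assms(2) by (auto simp: continuous_map_componentwise)
qed (use assms(1) in auto)

lemma continuous_map_complex_mult: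
  fixes f g :: "'a \<Rightarrow> complex"
  assumes "continuous_map S euclidean f" "continuous_map S euclidean g"
  shows "continuous_map S euclidean (\<lambda>x. f x * g x)"
proof -
  have "continuous_map S (prod_topology euclidean euclidean) (\<lambda>x. (f x, g x))"
    using assms by (rule continuous_map_pairedI)
  moreover have "continuous_map (prod_topology euclidean euclidean) euclidean (\<lambda>p::complex \<times> complex. fst p * snd p)"
    by (simp add: euclidean_product_topology prod_topology_euclidean continuous_map_iff_continuous2 continuous_intros)
  ultimately have "continuous_map S euclidean ((\<lambda>p::complex \<times> complex. fst p * snd p) \<circ> (\<lambda>x. (f x, g x)))"
    by (rule continuous_map_compose)
  then show ?thesis by (simp add: o_def)
qed

text \<open>A basic open set restricts finitely many coordinates. Hence \<open>f\<close> near one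
  point is governed by finitely many characters, and along a sequence of points by countably
  many.\<close>

lemma character_topology_neighbourhood:
  assumes f: "continuous_map (character_topology G Y) euclideanreal f" and x: "x \<in> carrier G"
  obtains F \<epsilon> where "finite F" "F \<subseteq> Y" "\<epsilon> > 0"
    "\<And>h. h \<in> carrier G \<Longrightarrow> (\<And>y. y \<in> F \<Longrightarrow> dist (y h) (y x) < \<epsilon>) \<Longrightarrow> \<bar>f h - f x\<bar> < 1"
proof -
  let ?e = "\<lambda>g. \<lambda>y\<in>Y. y g"
  have "openin (character_topology G Y) {h \<in> carrier G. f h \<in> ball (f x) 1}"
    using openin_continuous_map_preimage[OF f, of "ball (f x) 1"] by simp
  then obtain U where U: "openin (product_topology (\<lambda>_. euclidean) Y) U"
    "{h \<in> carrier G. f h \<in> ball (f x) 1} = ?e -` U \<inter> carrier G"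
    unfolding character_topology_def openin_pullback_topology by blast
  have "?e x \<in> U" using x U(2) by auto
  then obtain V where V: "finite {y \<in> Y. V y \<noteq> UNIV}" "\<And>y. y \<in> Y \<Longrightarrow> open (V y)"
    "?e x \<in> Pi\<^sub>E Y V" "Pi\<^sub>E Y V \<subseteq> U"
    using U(1) unfolding openin_product_topology_alt by force
  have "\<exists>e>0. ball (y x) e \<subseteq> V y" if "y \<in> Y" for y
    using V(2)[OF that] V(3) that open_contains_ball by (metis PiE_mem restrict_apply')
  then obtain e where e: "\<And>y. y \<in> Y \<Longrightarrow> e y > 0 \<and> ball (y x) (e y) \<subseteq> V y"
    by metis
  define F where "F = {y \<in> Y. V y \<noteq> UNIV}"
  \<comment> \<open>The inserted 1 keeps the minimum meaningful when \<open>F\<close> is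
    empty.\<close>
  define \<epsilon> where "\<epsilon> = Min (insert 1 (e ` F))"
  have fin: "finite F" using V(1) by (simp add: F_def)
  show ?thesis
  proof (rule that[of F \<epsilon>])
    show "finite F" by (rule fin)
    show "F \<subseteq> Y" by (auto simp: F_def)
    show "\<epsilon> > 0" using fin e by (auto simp: \<epsilon>_def F_def)
    fix h assume h: "h \<in> carrier G" "\<And>y. y \<in> F \<Longrightarrow> dist (y h) (y x) < \<epsilon>"
    have "y h \<in> V y" if "y \<in> Y" for y
    proof (cases "y \<in> F")
      case True
      have "\<epsilon> \<le> e y" unfolding \<epsilon>_def using True fin by (intro Min_le) auto
      then have "y h \<in> ball (y x) (e y)" using h(2)[OF True] by (simp add: dist_commute)
      then show ?thesis using e[OF that] by blast
    qed (use that in \<open>auto simp: F_def\<close>)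
    then have "?e h \<in> U" using V(4) by auto
    then have "f h \<in> ball (f x) 1" using U(2) h(1) by blast
    then show "\<bar>f h - f x\<bar> < 1" by (simp add: dist_real_def abs_minus_commute)
  qed
qed

text \<open>A countable power of the circle is compact and metrisable, hence sequentially
  compact.\<close>

lemma sphere_seqs_convergent_subseq:
  fixes w :: "nat \<Rightarrow> nat \<Rightarrow> complex"
  assumes "\<And>n i. w n i \<in> sphere 0 1"
  obtains r z where "strict_mono (r :: nat \<Rightarrow> nat)" "\<And>i. (\<lambda>n. w (r n) i) \<longlonglongrightarrow> z i"
proof -
  have "compactin (product_topology (\<lambda>_::nat. euclidean) UNIV) (Pi\<^sub>E UNIV (\<lambda>_. sphere (0::complex) 1))"
    by (subst compactin_PiE) auto
  then have "compact (Pi\<^sub>E (UNIV::nat set) (\<lambda>_. sphere (0::complex) 1))"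
    by (simp add: euclidean_product_topology)
  then have "seq_compact (Pi\<^sub>E (UNIV::nat set) (\<lambda>_. sphere (0::complex) 1))"
    by (simp add: compact_eq_seq_compact_metric)
  moreover have "\<forall>n. w n \<in> Pi\<^sub>E UNIV (\<lambda>_. sphere 0 1)" using assms by auto
  ultimately obtain z r where r: "strict_mono r" "(w \<circ> r) \<longlonglongrightarrow> z"
    unfolding seq_compact_def by blast
  have "(\<lambda>n. w (r n) i) \<longlonglongrightarrow> z i" for i
  proof -
    have "isCont (\<lambda>x::nat \<Rightarrow> complex. x i) z"
      by (metis UNIV_I continuous_on_eq_continuous_at continuous_on_product_coordinates open_UNIV)
    from isCont_tendsto_compose[OF this r(2)] show ?thesis by (simp add: o_def)
  qed
  then show ?thesis using that r(1) by blast
qed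

text \<open>Let \<open>f\<close> be unbounded along \<open>x n\<close>, and let \<open>B\<close> be
  the countable set of characters governing \<open>f\<close> near these points. On \<open>B\<close>
  a subsequence converges to values realised by some \<open>g\<close>. The points
  \<open>x (r n)\<close> themselves need not approach \<open>g\<close>, as a neighbourhood of
  \<open>g\<close> may use characters outside \<open>B\<close>. They are replaced by points
  \<open>h n\<close> that look like \<open>x (r n)\<close> on \<open>B\<close> and like
  \<open>g\<close> on the remaining characters of that neighbourhood. Then \<open>f (h n)\<close> is
  close to \<open>f (x (r n))\<close> always and to \<open>f g\<close> eventually, so the former
  cannot be unbounded.\<close>

lemma interpolating_pseudocompact:
  assumes Y: "interpolating G Y"
  shows "pseudocompact_space (character_topology G Y)"
  unfolding pseudocompact_space_def
proof (intro allI impI, rule ccontr)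
  fix f assume f: "continuous_map (character_topology G Y) euclideanreal f"
    and "\<not> bounded (f ` topspace (character_topology G Y))"
  then have "\<exists>x\<in>carrier G. \<bar>f x\<bar> > real n" for n
    by (force simp: bounded_iff not_le)
  then obtain x where x: "\<And>n. x n \<in> carrier G" "\<And>n. \<bar>f (x n)\<bar> > real n"
    by metis
  have "\<exists>F. finite F \<and> F \<subseteq> Y \<and> (\<forall>h\<in>carrier G. (\<forall>y\<in>F. y h = y (x n)) \<longrightarrow> \<bar>f h - f (x n)\<bar> < 1)" for n
  proof -
    obtain F \<epsilon> where F: "finite F" "F \<subseteq> Y" "\<epsilon> > 0"
      "\<And>h. h \<in> carrier G \<Longrightarrow> (\<And>y. y \<in> F \<Longrightarrow> dist (y h) (y (x n)) < \<epsilon>) \<Longrightarrow> \<bar>f h - f (x n)\<bar> < 1"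
      using character_topology_neighbourhood[OF f x(1)] by metis
    then show ?thesis by (intro exI[of _ F] conjI ballI impI F) auto
  qed
  then obtain F where F: "\<And>n. finite (F n)" "\<And>n. F n \<subseteq> Y"
    "\<And>n h. h \<in> carrier G \<Longrightarrow> (\<And>y. y \<in> F n \<Longrightarrow> y h = y (x n)) \<Longrightarrow> \<bar>f h - f (x n)\<bar> < 1"
    by metis
  define B where "B = (\<Union>n. F n)"
  have B: "countable B" "B \<subseteq> Y"
    using F by (auto simp: B_def intro: countable_finite)
  have Yc: "y g \<in> sphere 0 1" if "y \<in> Y" "g \<in> carrier G" for y g
    using hom_in_carrier[OF interpolating_hom[OF Y that(1)] that(2)] by simp
  define b where "b = from_nat_into B"
  \<comment> \<open>The default 1 covers an empty \<open>B\<close>, where the enumeration takes an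
    arbitrary value.\<close>
  define w where "w n i = (if b i \<in> B then b i (x n) else 1)" for n i
  have "w n i \<in> sphere 0 1" for n i
    using Yc[of "b i" "x n"] B(2) x(1) by (auto simp: w_def)
  then obtain r z where r: "strict_mono (r :: nat \<Rightarrow> nat)" "\<And>i. (\<lambda>n. w (r n) i) \<longlonglongrightarrow> z i"
    by (rule sphere_seqs_convergent_subseq[of w]) (rule that)
  define c where "c y = z (SOME i. b i = y)" for y
  have conv: "(\<lambda>n. y (x (r n))) \<longlonglongrightarrow> c y" if "y \<in> B" for y
  proof -
    have "\<exists>i. b i = y" using from_nat_into_surj[OF B(1) that] by (simp add: b_def)
    then have "b (SOME i. b i = y) = y" by (rule someI_ex)
    then show ?thesis using r(2)[of "SOME i. b i = y"] that by (simp add: w_def c_def)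
  qed
  have "c y \<in> y ` carrier G" if "y \<in> B" for y
  proof (rule closed_sequentially[OF _ _ conv[OF that]])
    show "closed (y ` carrier G)" using interpolating_closed[OF Y] B(2) that by blast
  qed (use x(1) in auto)
  then obtain g where g: "g \<in> carrier G" "\<And>y. y \<in> B \<Longrightarrow> y g = c y"
    using interpolating_point[OF Y B, of c] by metis
  obtain E \<epsilon> where E: "finite E" "E \<subseteq> Y" "\<epsilon> > 0"
    "\<And>h. h \<in> carrier G \<Longrightarrow> (\<And>y. y \<in> E \<Longrightarrow> dist (y h) (y g) < \<epsilon>) \<Longrightarrow> \<bar>f h - f g\<bar> < 1"
    using character_topology_neighbourhood[OF f g(1)] by metis
  have "\<exists>h\<in>carrier G. \<forall>y\<in>B \<union> E. y h = (if y \<in> B then y (x (r n)) else y g)" for n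
  proof -
    have BE: "countable (B \<union> E)" "B \<union> E \<subseteq> Y"
      using B E by (auto intro: countable_finite)
    have "(if y \<in> B then y (x (r n)) else y g) \<in> y ` carrier G" for y
      using x(1) g(1) by auto
    then show ?thesis
      using interpolating_point[OF Y BE, of "\<lambda>y. if y \<in> B then y (x (r n)) else y g"] by metis
  qed
  then obtain h where h: "\<And>n. h n \<in> carrier G"
    "\<And>n y. y \<in> B \<union> E \<Longrightarrow> y (h n) = (if y \<in> B then y (x (r n)) else y g)"
    by metis
  have near: "\<bar>f (h n) - f (x (r n))\<bar> < 1" for n
  proof (rule F(3)[OF h(1)])
    fix y assume "y \<in> F (r n)"
    then have "y \<in> B" by (auto simp: B_def)
    then show "y (h n) = y (x (r n))" using h(2)[of y n] by simp
  qed
  have "\<forall>\<^sub>F n in sequentially. \<forall>y\<in>E. dist (y (h n)) (y g) < \<epsilon>"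
  proof (intro eventually_ball_finite E(1) ballI)
    fix y assume y: "y \<in> E"
    show "\<forall>\<^sub>F n in sequentially. dist (y (h n)) (y g) < \<epsilon>"
    proof (cases "y \<in> B")
      case True
      then have "y (h n) = y (x (r n))" for n using h(2)[of y n] by simp
      then show ?thesis
        unfolding g(2)[OF True] using tendstoD[OF conv[OF True] E(3)] by simp
    next
      case False
      then have "y (h n) = y g" for n using h(2)[of y n] y by simp
      then show ?thesis using E(3) by simp
    qed
  qed
  then obtain N where N: "\<And>n. n \<ge> N \<Longrightarrow> \<forall>y\<in>E. dist (y (h n)) (y g) < \<epsilon>"
    by (auto simp: eventually_sequentially)
  \<comment> \<open>The summand 2 pays for the two errors below 1, between \<open>h n\<close> and
    \<open>g\<close> and between \<open>h n\<close> and \<open>x (r n)\<close>.\<close>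
  define n where "n = max N (nat \<lceil>\<bar>f g\<bar> + 2\<rceil>)"
  have "\<bar>f (h n) - f g\<bar> < 1"
    using N[of n] by (intro E(4) h(1)) (auto simp: n_def)
  moreover have "real n \<le> real (r n)"
    using seq_suble[OF r(1), of n] by simp
  moreover have "\<bar>f g\<bar> + 2 \<le> real n"
    unfolding n_def by linarith
  ultimately show False
    using near[of n] x(2)[of "r n"] by linarith
qed

context comm_group
begin

text \<open>It suffices to choose a value other than 1 at \<open>g\<close> that respects the order
  of \<open>g\<close>: -1 if the order is infinite (\<open>ord g = 0\<close>), a nontrivial root of
  unity otherwise. Extension does the rest.\<close>

lemma exists_character_separating:
  assumes g: "g \<in> carrier G" "g \<noteq> \<one>"
  obtains f where "f \<in> hom G circle_group" "f g \<noteq> 1"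
proof -
  obtain v :: complex where v: "v \<in> sphere 0 1" "v \<noteq> 1" "v ^ ord g = 1"
  proof (cases "ord g = 0")
    case True
    then show ?thesis using that[of "-1"] by auto
  next
    case False
    have "ord g \<noteq> 1" using g ord_eq_1 by blast
    have "card {z::complex. z ^ ord g = 1} = ord g"
      using False by (intro card_roots_unity_eq) auto
    then have "\<not> {z::complex. z ^ ord g = 1} \<subseteq> {1}"
      using False \<open>ord g \<noteq> 1\<close> card_mono[of "{1::complex}" "{z. z ^ ord g = 1}"] by auto
    then obtain v :: complex where v: "v ^ ord g = 1" "v \<noteq> 1" by blast
    moreover have "norm v = 1"
      using v(1) False by (metis norm_one norm_power power_eq_1_iff norm_ge_zero)
    ultimately show ?thesis using that[of v] by auto
  qed
  have "coherent G ((\<lambda>_. 1)(g := v)) (insert g {})"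
  proof (rule coherent_insert)
    fix n :: int and w assume "(g [^] n, w) \<in> graph_gen G (\<lambda>_. 1) {}"
    then have "g [^] n = \<one>" "w = 1"
      using group.generate_empty[OF DirProd_group[OF is_group group_circle]] by (auto simp: graph_gen_def)
    then obtain k where "n = int (ord g) * k" using g(1) int_pow_eq_id by (auto elim: dvdE)
    then show "w = v powi n" using \<open>w = 1\<close> v(3) by (simp add: power_int_mult)
  qed (use g v coherent_empty in auto)
  then obtain f where "f \<in> hom G circle_group" "\<And>b. b \<in> {g} \<Longrightarrow> f b = ((\<lambda>_. 1)(g := v)) b"
    using character_extension[of "{g}" "(\<lambda>_. 1)(g := v)"] g v by auto
  then show ?thesis using that v by auto
qed

lemma coherent_subgroup_hom:
  assumes N: "subgroup N G" and f: "f \<in> N \<rightarrow> sphere 0 1"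
    and m: "\<And>x y. x \<in> N \<Longrightarrow> y \<in> N \<Longrightarrow> f (x \<otimes> y) = f x * f y"
  shows "coherent G f N"
proof -
  interpret N: subgroup N G by fact
  have nz: "f x \<noteq> 0" if "x \<in> N" for x using f that by force
  have f1: "f \<one> = 1"
    using m[of \<one> \<one>] nz[of \<one>] by simp
  have finv: "f (inv x) = inverse (f x)" if "x \<in> N" for x
    using m[of x "inv x"] that nz f1 by (simp add: field_simps)
  have "fst p \<in> N \<and> snd p = f (fst p)" if "p \<in> graph_gen G f N" for p
    using that unfolding graph_gen_def
  proof (induction rule: generate.induct)
    case (inv h)
    then obtain x where x: "h = (x, f x)" "x \<in> N" by auto
    then have "f x \<in> sphere 0 1" "x \<in> carrier G" using f by auto
    then show ?case
      using x by (simp add: inv_DirProd[OF is_group group_circle] inv_circle finv)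
  qed (auto simp: f1 m mult_DirProd')
  then show ?thesis unfolding coherent_def by (metis f1 fst_conv snd_conv)
qed

lemma hom_prod_list:
  assumes "set ys \<subseteq> hom G circle_group"
  shows "(\<lambda>x. \<Prod>y\<leftarrow>ys. y x) \<in> hom G circle_group"
  using assms
proof (induction ys)
  case (Cons y ys)
  then show ?case by (auto simp: hom_def Pi_iff norm_mult)
qed (auto simp: hom_def)

text \<open>Points are separated by characters of \<open>G\<close>, and agreement on the countable
  set \<open>{g, h}\<close> passes this on to \<open>Y\<close>. For property h, a character of a
  countable \<open>N\<close> first extends to \<open>G\<close> algebraically, without regard to
  continuity; a product of members of \<open>Y\<close> agreeing with it on \<open>N\<close> is the
  continuous extension.\<close>

theorem interpolating_imp_topology:
  assumes Y: "interpolating G Y"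
  shows "group_topology G (character_topology G Y) \<and> pseudocompact_space (character_topology G Y) \<and>
    property_h G (character_topology G Y)"
proof (intro conjI)
  let ?T = "character_topology G Y"
  have Yhom: "y \<in> hom G circle_group" if "y \<in> Y" for y
    using interpolating_hom[OF Y that] .
  have ext: "\<exists>ys. set ys \<subseteq> Y \<and> (\<forall>x\<in>N. f x = (\<Prod>y\<leftarrow>ys. y x))"
    if "countable N" "N \<subseteq> carrier G" "f \<in> hom G circle_group" for N f
    using interpolating_character[OF Y that] by metis
  show "pseudocompact_space ?T" using Y by (rule interpolating_pseudocompact)
  show "group_topology G ?T"
    unfolding group_topology_def
  proof (intro conjI)
    show "topspace ?T = carrier G" by simp
    have sep: "g = h" if g: "g \<in> carrier G" "h \<in> carrier G" and eq: "\<And>y. y \<in> Y \<Longrightarrow> y g = y h" for g h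
    proof (rule ccontr)
      assume "g \<noteq> h"
      then have "g \<otimes> inv h \<noteq> \<one>" using g by (metis inv_closed inv_equality inv_inv)
      then obtain f where f: "f \<in> hom G circle_group" "f (g \<otimes> inv h) \<noteq> 1"
        using exists_character_separating[of "g \<otimes> inv h"] g by auto
      interpret F: group_hom G circle_group f
        by (intro group_hom.intro group_hom_axioms.intro is_group group_circle f)
      obtain ys where ys: "set ys \<subseteq> Y" "\<forall>x\<in>{g, h}. f x = (\<Prod>y\<leftarrow>ys. y x)"
        using ext[of "{g, h}" f] f(1) g by auto
      have "map (\<lambda>y. y g) ys = map (\<lambda>y. y h) ys" using ys(1) eq by auto
      then have "(\<Prod>y\<leftarrow>ys. y g) = (\<Prod>y\<leftarrow>ys. y h)" by (rule arg_cong)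
      then have "f g = f h" using ys(2) by simp
      moreover have fh: "f h \<in> sphere 0 1" using F.hom_closed[OF g(2)] by simp
      then have "f h \<noteq> 0" by auto
      moreover have "f (g \<otimes> inv h) = f g * inverse (f h)"
        using g by (simp add: inv_circle[OF fh])
      ultimately have "f (g \<otimes> inv h) = 1" by simp
      then show False using f(2) by simp
    qed
    show "Hausdorff_space ?T"
    proof (rule Hausdorff_space_injective_preimage)
      show "Hausdorff_space (product_topology (\<lambda>_. euclidean :: complex topology) Y)"
        using Hausdorff_space_product_topology Hausdorff_space_euclidean by blast
      show "continuous_map ?T (product_topology (\<lambda>_. euclidean) Y) (\<lambda>g. \<lambda>y\<in>Y. y g)"
        unfolding continuous_map_componentwise
        by (intro conjI ballI) (simp_all add: continuous_map_character image_subset_iff)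
      show "inj_on (\<lambda>g. \<lambda>y\<in>Y. y g) (topspace ?T)"
      proof (rule inj_onI)
        fix g h assume g: "g \<in> topspace ?T" "h \<in> topspace ?T" and e: "(\<lambda>y\<in>Y. y g) = (\<lambda>y\<in>Y. y h)"
        have "y g = y h" if "y \<in> Y" for y
        proof -
          have "(\<lambda>y\<in>Y. y g) y = (\<lambda>y\<in>Y. y h) y" by (rule fun_cong[OF e])
          then show ?thesis by (simp only: restrict_apply'[OF that])
        qed
        then show "g = h" using g by (intro sep) simp_all
      qed
    qed
    show "continuous_map (prod_topology ?T ?T) ?T (\<lambda>(x, y). x \<otimes> y)"
    proof (rule continuous_map_into_character_topology)
      fix y assume y: "y \<in> Y"
      have "continuous_map (prod_topology ?T ?T) euclidean (\<lambda>p. y (fst p) * y (snd p))"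
        by (intro continuous_map_complex_mult
            continuous_map_compose[OF continuous_map_fst continuous_map_character[OF y], unfolded o_def]
            continuous_map_compose[OF continuous_map_snd continuous_map_character[OF y], unfolded o_def])
      then show "continuous_map (prod_topology ?T ?T) euclidean (\<lambda>p. y (case p of (x, y) \<Rightarrow> x \<otimes> y))"
        by (rule continuous_map_eq) (use hom_mult[OF Yhom[OF y]] in auto)
    qed auto
    show "continuous_map ?T ?T (m_inv G)"
    proof (rule continuous_map_into_character_topology)
      fix y assume y: "y \<in> Y"
      interpret F: group_hom G circle_group y
        by (intro group_hom.intro group_hom_axioms.intro is_group group_circle Yhom y)
      \<comment> \<open>On the circle inversion is conjugation, which is continuous on all of the
        plane.\<close>
      have "continuous_map euclidean euclidean cnj"
        by (simp add: continuous_map_iff_continuous2 continuous_intros)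
      then have "continuous_map ?T euclidean (cnj \<circ> y)"
        using continuous_map_compose[OF continuous_map_character[OF y]] by blast
      then show "continuous_map ?T euclidean (\<lambda>x. y (inv x))"
      proof (rule continuous_map_eq)
        fix x assume "x \<in> topspace ?T"
        then have x: "x \<in> carrier G" by simp
        then have s: "y x \<in> sphere 0 1" using F.hom_closed by force
        then have "y x * cnj (y x) = 1" by (simp add: complex_norm_square[symmetric])
        then show "(cnj \<circ> y) x = y (inv x)"
          using x s by (simp add: inv_circle inverse_unique)
      qed
    qed auto
  qed
  show "property_h G ?T"
    unfolding property_h_def h_embedded_def
  proof (intro allI impI ballI, elim conjE)
    fix N f assume N: "subgroup N G" "countable N" and f: "f \<in> hom (subgroup_generated G N) circle_group"
    have cN: "carrier (subgroup_generated G N) = N"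
      using N(1) by (rule subgroup.carrier_subgroup_generated_subgroup)
    have fs: "f \<in> N \<rightarrow> sphere 0 1" and fm: "\<And>x y. x \<in> N \<Longrightarrow> y \<in> N \<Longrightarrow> f (x \<otimes> y) = f x * f y"
      using f unfolding hom_def cN by auto
    have NG: "N \<subseteq> carrier G" using N(1) by (rule subgroup.subset)
    obtain f' where f': "f' \<in> hom G circle_group" "\<And>b. b \<in> N \<Longrightarrow> f' b = f b"
      using character_extension[OF NG fs coherent_subgroup_hom[OF N(1) fs fm]] by metis
    obtain ys where ys: "set ys \<subseteq> Y" "\<forall>x\<in>N. f' x = (\<Prod>y\<leftarrow>ys. y x)"
      using ext[OF N(2) NG f'(1)] by metis
    define a where "a x = (\<Prod>y\<leftarrow>ys. y x)" for x
    have a: "a \<in> hom G circle_group"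
      unfolding a_def using ys(1) Yhom by (intro hom_prod_list) auto
    have "continuous_map ?T euclidean (\<lambda>x. \<Prod>y\<leftarrow>ys. y x)"
      using ys(1)
    proof (induction ys)
      case (Cons y ys)
      then show ?case
        using continuous_map_complex_mult[of ?T y "\<lambda>x. \<Prod>y\<leftarrow>ys. y x"] continuous_map_character[of y Y G] by simp
    qed simp
    then have "continuous_map ?T euclidean a" by (simp add: a_def[abs_def])
    moreover have "a x \<in> sphere 0 1" if "x \<in> carrier G" for x
      using hom_in_carrier[OF a that] by simp
    ultimately have ca: "continuous_map ?T circle_top a"
      unfolding circle_top_def continuous_map_in_subtopology by auto
    have "a x = f x" if "x \<in> N" for x
      using f'(2)[OF that] ys(2) that by (simp add: a_def)
    then show "\<exists>g\<in>hom G circle_group. continuous_map ?T circle_top g \<and> (\<forall>x\<in>N. g x = f x)"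
      using a ca by blast
  qed
qed

end

section \<open>Products and isomorphic copies of interpolating families\<close>

lemma interpolatingI:
  assumes "\<And>y. y \<in> Y \<Longrightarrow> y \<in> hom G circle_group"
    and "\<And>y. y \<in> Y \<Longrightarrow> closed (y ` carrier G)"
    and "\<And>B t. countable B \<Longrightarrow> B \<subseteq> Y \<Longrightarrow> (\<And>y. y \<in> B \<Longrightarrow> t y \<in> y ` carrier G) \<Longrightarrow>
      \<exists>g\<in>carrier G. \<forall>y\<in>B. y g = t y"
    and "\<And>N f. countable N \<Longrightarrow> N \<subseteq> carrier G \<Longrightarrow> f \<in> hom G circle_group \<Longrightarrow>
      \<exists>ys. set ys \<subseteq> Y \<and> (\<forall>x\<in>N. f x = (\<Prod>y\<leftarrow>ys. y x))"
  shows "interpolating G Y"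
  unfolding interpolating_def
proof (intro conjI ballI allI impI subsetI; (elim conjE)?)
  fix B t assume "countable B" "B \<subseteq> Y" "\<forall>y\<in>B. t y \<in> y ` carrier G"
  then show "\<exists>g\<in>carrier G. \<forall>y\<in>B. y g = t y" by (intro assms(3)) auto
qed (use assms(1,2,4) in auto)

lemma interpolating_trivial:
  assumes G: "group G" and triv: "carrier G = {\<one>\<^bsub>G\<^esub>}"
  shows "interpolating G {}"
proof (rule interpolatingI)
  fix N f assume N: "N \<subseteq> carrier G" and f: "f \<in> hom G circle_group"
  have "f \<one>\<^bsub>G\<^esub> = 1" using hom_one[OF f G group_circle] by simp
  then show "\<exists>ys. set ys \<subseteq> {} \<and> (\<forall>x\<in>N. f x = (\<Prod>y\<leftarrow>ys. y x))"
    using N triv by (intro exI[of _ "[]"]) auto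
qed (use triv in auto)

text \<open>Prescriptions for the two halves of the family concern different coordinates of the
  point sought, and a character splits as the product of its restrictions to the factors.\<close>

lemma interpolating_DirProd:
  assumes G1: "group G1" and G2: "group G2" and Y1: "interpolating G1 Y1" and Y2: "interpolating G2 Y2"
  shows "interpolating (G1 \<times>\<times> G2) ((\<lambda>y. y \<circ> fst) ` Y1 \<union> (\<lambda>y. y \<circ> snd) ` Y2)"
proof (rule interpolatingI)
  interpret G1: group G1 by fact
  interpret G2: group G2 by fact
  have im1: "(y \<circ> fst) ` carrier (G1 \<times>\<times> G2) = y ` carrier G1" for y :: "_ \<Rightarrow> complex"
    using G2.one_closed unfolding carrier_DirProd image_comp[symmetric] fst_image_times by auto
  have im2: "(y \<circ> snd) ` carrier (G1 \<times>\<times> G2) = y ` carrier G2" for y :: "_ \<Rightarrow> complex"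
    using G1.one_closed unfolding carrier_DirProd image_comp[symmetric] snd_image_times by auto
  fix y assume y: "y \<in> (\<lambda>y. y \<circ> fst) ` Y1 \<union> (\<lambda>y. y \<circ> snd) ` Y2"
  show "y \<in> hom (G1 \<times>\<times> G2) circle_group"
    using y
  proof
    assume "y \<in> (\<lambda>y. y \<circ> fst) ` Y1"
    then obtain z where "z \<in> hom G1 circle_group" "y = z \<circ> fst"
      using interpolating_hom[OF Y1] by blast
    then show ?thesis by (auto simp: hom_def Pi_iff)
  next
    assume "y \<in> (\<lambda>y. y \<circ> snd) ` Y2"
    then obtain z where "z \<in> hom G2 circle_group" "y = z \<circ> snd"
      using interpolating_hom[OF Y2] by blast
    then show ?thesis by (auto simp: hom_def Pi_iff)
  qed
  show "closed (y ` carrier (G1 \<times>\<times> G2))"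
    using y interpolating_closed[OF Y1] interpolating_closed[OF Y2] by (elim UnE imageE) (simp_all only: im1 im2)
next
  interpret G1: group G1 by fact
  interpret G2: group G2 by fact
  have im1: "(y \<circ> fst) ` carrier (G1 \<times>\<times> G2) = y ` carrier G1" for y :: "_ \<Rightarrow> complex"
    using G2.one_closed unfolding carrier_DirProd image_comp[symmetric] fst_image_times by auto
  have im2: "(y \<circ> snd) ` carrier (G1 \<times>\<times> G2) = y ` carrier G2" for y :: "_ \<Rightarrow> complex"
    using G1.one_closed unfolding carrier_DirProd image_comp[symmetric] snd_image_times by auto
  fix B t assume B: "countable B" "B \<subseteq> (\<lambda>y. y \<circ> fst) ` Y1 \<union> (\<lambda>y. y \<circ> snd) ` Y2"
    and t: "\<And>y. y \<in> B \<Longrightarrow> t y \<in> y ` carrier (G1 \<times>\<times> G2)"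
  define B1 where "B1 = {y \<in> Y1. y \<circ> fst \<in> B}"
  define B2 where "B2 = {y \<in> Y2. y \<circ> snd \<in> B}"
  have i: "inj_on (\<lambda>y. y \<circ> fst) B1" "inj_on (\<lambda>y. y \<circ> snd) B2"
    by (auto simp: inj_on_def fun_eq_iff)
  have s: "(\<lambda>y. y \<circ> fst) ` B1 \<subseteq> B" "(\<lambda>y. y \<circ> snd) ` B2 \<subseteq> B"
    by (auto simp: B1_def B2_def)
  have cB: "countable B1" "countable B2"
    by (rule countable_image_inj_on[OF countable_subset[OF s(1) B(1)] i(1)],
        rule countable_image_inj_on[OF countable_subset[OF s(2) B(1)] i(2)])
  have B12: "B1 \<subseteq> Y1" "B2 \<subseteq> Y2" by (auto simp: B1_def B2_def)
  obtain g1 where g1: "g1 \<in> carrier G1" "\<And>y. y \<in> B1 \<Longrightarrow> y g1 = t (y \<circ> fst)"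
  proof (rule interpolating_point[OF Y1 cB(1) B12(1), of "\<lambda>y. t (y \<circ> fst)"])
    show "t (y \<circ> fst) \<in> y ` carrier G1" if "y \<in> B1" for y
      using t[of "y \<circ> fst"] that unfolding im1 by (simp add: B1_def)
  qed (rule that)
  obtain g2 where g2: "g2 \<in> carrier G2" "\<And>y. y \<in> B2 \<Longrightarrow> y g2 = t (y \<circ> snd)"
  proof (rule interpolating_point[OF Y2 cB(2) B12(2), of "\<lambda>y. t (y \<circ> snd)"])
    show "t (y \<circ> snd) \<in> y ` carrier G2" if "y \<in> B2" for y
      using t[of "y \<circ> snd"] that unfolding im2 by (simp add: B2_def)
  qed (rule that)
  have "y (g1, g2) = t y" if "y \<in> B" for y
  proof -
    \<comment> \<open>A constant function may belong to both halves; as \<open>t\<close> is indexed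
      by the function itself, either representation gives the same value.\<close>
    have "(\<exists>z\<in>B1. y = z \<circ> fst) \<or> (\<exists>z\<in>B2. y = z \<circ> snd)"
      using B(2) that by (auto simp: B1_def B2_def)
    then show ?thesis using g1(2) g2(2) by auto
  qed
  then show "\<exists>g\<in>carrier (G1 \<times>\<times> G2). \<forall>y\<in>B. y g = t y"
    using g1(1) g2(1) by (intro bexI[of _ "(g1, g2)"]) auto
next
  interpret G1: group G1 by fact
  interpret G2: group G2 by fact
  fix N f assume N: "countable N" "N \<subseteq> carrier (G1 \<times>\<times> G2)" and f: "f \<in> hom (G1 \<times>\<times> G2) circle_group"
  have f1: "(\<lambda>x. f (x, \<one>\<^bsub>G2\<^esub>)) \<in> hom G1 circle_group" and f2: "(\<lambda>x. f (\<one>\<^bsub>G1\<^esub>, x)) \<in> hom G2 circle_group"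
    using hom_mult[OF f, of "(_, \<one>\<^bsub>G2\<^esub>)" "(_, \<one>\<^bsub>G2\<^esub>)"] hom_mult[OF f, of "(\<one>\<^bsub>G1\<^esub>, _)" "(\<one>\<^bsub>G1\<^esub>, _)"]
      hom_in_carrier[OF f] by (auto intro!: homI)
  have N1: "countable (fst ` N)" "fst ` N \<subseteq> carrier G1" and N2: "countable (snd ` N)" "snd ` N \<subseteq> carrier G2"
    using N by auto
  obtain ys1 where ys1: "set ys1 \<subseteq> Y1" "\<And>x. x \<in> fst ` N \<Longrightarrow> f (x, \<one>\<^bsub>G2\<^esub>) = (\<Prod>y\<leftarrow>ys1. y x)"
    using interpolating_character[OF Y1 N1 f1] by metis
  obtain ys2 where ys2: "set ys2 \<subseteq> Y2" "\<And>x. x \<in> snd ` N \<Longrightarrow> f (\<one>\<^bsub>G1\<^esub>, x) = (\<Prod>y\<leftarrow>ys2. y x)"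
    using interpolating_character[OF Y2 N2 f2] by metis
  let ?ys = "map (\<lambda>y. y \<circ> fst) ys1 @ map (\<lambda>y. y \<circ> snd) ys2"
  have "f x = (\<Prod>y\<leftarrow>?ys. y x)" if "x \<in> N" for x
  proof -
    have xc: "fst x \<in> carrier G1" "snd x \<in> carrier G2" using N(2) that by auto
    then have "f x = f ((fst x, \<one>\<^bsub>G2\<^esub>) \<otimes>\<^bsub>G1 \<times>\<times> G2\<^esub> (\<one>\<^bsub>G1\<^esub>, snd x))" by simp
    also have "\<dots> = f (fst x, \<one>\<^bsub>G2\<^esub>) * f (\<one>\<^bsub>G1\<^esub>, snd x)"
      using hom_mult[OF f, of "(fst x, \<one>\<^bsub>G2\<^esub>)" "(\<one>\<^bsub>G1\<^esub>, snd x)"] xc by simp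
    also have "\<dots> = (\<Prod>y\<leftarrow>?ys. y x)"
      using ys1(2)[of "fst x"] ys2(2)[of "snd x"] that by (simp add: o_def)
    finally show ?thesis .
  qed
  then show "\<exists>ys. set ys \<subseteq> (\<lambda>y. y \<circ> fst) ` Y1 \<union> (\<lambda>y. y \<circ> snd) ` Y2 \<and> (\<forall>x\<in>N. f x = (\<Prod>y\<leftarrow>ys. y x))"
    using ys1(1) ys2(1) by (intro exI[of _ ?ys]) auto
qed

lemma interpolating_iso:
  assumes G: "group G" and H: "group H" and \<phi>: "\<phi> \<in> iso G H" and Y: "interpolating H Y"
  shows "interpolating G ((\<lambda>y. y \<circ> \<phi>) ` Y)"
proof (rule interpolatingI)
  have hom: "\<phi> \<in> hom G H" and sur: "\<phi> ` carrier G = carrier H"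
    using \<phi> by (auto simp: iso_def bij_betw_def)
  fix y assume "y \<in> (\<lambda>y. y \<circ> \<phi>) ` Y"
  then obtain z where z: "z \<in> Y" "y = z \<circ> \<phi>" by blast
  show "y \<in> hom G circle_group"
    unfolding z(2) by (rule hom_compose[OF hom interpolating_hom[OF Y z(1)]])
  show "closed (y ` carrier G)"
    using interpolating_closed[OF Y z(1)] unfolding z(2) image_comp[symmetric] sur .
next
  have sur: "\<phi> ` carrier G = carrier H"
    using \<phi> by (auto simp: iso_def bij_betw_def)
  fix B t assume B: "countable B" "B \<subseteq> (\<lambda>y. y \<circ> \<phi>) ` Y" and t: "\<And>y. y \<in> B \<Longrightarrow> t y \<in> y ` carrier G"
  \<comment> \<open>Members of \<open>Y\<close> that differ off the image of \<phi> can have the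
    same pullback, so one representative is chosen for each \<open>b\<close>.\<close>
  have "\<forall>b\<in>B. \<exists>z\<in>Y. b = z \<circ> \<phi>" using B(2) by blast
  then obtain p where p: "\<And>b. b \<in> B \<Longrightarrow> p b \<in> Y" "\<And>b. b \<in> B \<Longrightarrow> b = p b \<circ> \<phi>" by metis
  have pB: "countable (p ` B)" "p ` B \<subseteq> Y" using B(1) p(1) by auto
  obtain h where h: "h \<in> carrier H" "\<And>z. z \<in> p ` B \<Longrightarrow> z h = t (z \<circ> \<phi>)"
  proof (rule interpolating_point[OF Y pB, of "\<lambda>z. t (z \<circ> \<phi>)"])
    fix z assume "z \<in> p ` B"
    then have "z \<circ> \<phi> \<in> B" using p(2) by auto
    then have "t (z \<circ> \<phi>) \<in> (z \<circ> \<phi>) ` carrier G" by (rule t)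
    then show "t (z \<circ> \<phi>) \<in> z ` carrier H" unfolding image_comp[symmetric] sur .
  qed (rule that)
  obtain g where g: "h = \<phi> g" "g \<in> carrier G"
    using h(1) unfolding sur[symmetric] by (rule imageE)
  have "b g = t b" if "b \<in> B" for b
  proof -
    have "b g = p b h" using fun_cong[OF p(2)[OF that], of g] g(1) by simp
    also have "\<dots> = t b" using h(2)[of "p b"] p(2)[OF that] that by simp
    finally show ?thesis .
  qed
  then show "\<exists>g\<in>carrier G. \<forall>y\<in>B. y g = t y" using g(2) by (intro bexI ballI)
next
  let ?\<psi> = "inv_into (carrier G) \<phi>"
  have hom: "\<phi> \<in> hom G H" and bij: "bij_betw \<phi> (carrier G) (carrier H)"
    using \<phi> by (auto simp: iso_def)
  have \<psi>: "?\<psi> \<in> hom H G" using group.iso_set_sym[OF G \<phi>] by (simp add: iso_def)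
  fix N f assume N: "countable N" "N \<subseteq> carrier G" and f: "f \<in> hom G circle_group"
  have "countable (\<phi> ` N)" "\<phi> ` N \<subseteq> carrier H" using N hom_in_carrier[OF hom] by auto
  then obtain zs where zs: "set zs \<subseteq> Y" "\<And>x. x \<in> \<phi> ` N \<Longrightarrow> (f \<circ> ?\<psi>) x = (\<Prod>y\<leftarrow>zs. y x)"
    using interpolating_character[OF Y _ _ hom_compose[OF \<psi> f]] by metis
  have "f x = (\<Prod>y\<leftarrow>map (\<lambda>y. y \<circ> \<phi>) zs. y x)" if "x \<in> N" for x
  proof -
    have "?\<psi> (\<phi> x) = x" using bij N(2) that by (meson bij_betw_inv_into_left subsetD)
    then have "f x = (\<Prod>y\<leftarrow>zs. y (\<phi> x))" using zs(2)[of "\<phi> x"] that by simp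
    then show ?thesis by (simp add: o_def)
  qed
  then show "\<exists>ys. set ys \<subseteq> (\<lambda>y. y \<circ> \<phi>) ` Y \<and> (\<forall>x\<in>N. f x = (\<Prod>y\<leftarrow>ys. y x))"
    using zs(1) by (intro exI[of _ "map (\<lambda>y. y \<circ> \<phi>) zs"]) auto
qed

section \<open>Groups of large torsion-free rank\<close>

text \<open>Fixing countably many coordinates of the torus cuts out a nonempty G_delta set, the
  intersection of the conditions that each coordinate lie within 1/(n+1) of its target.\<close>

lemma gdelta_dense_extends:
  assumes D: "gdelta_dense (torus W) D" and N: "countable N" "N \<subseteq> W" and t: "t \<in> N \<rightarrow> sphere 0 1"
  obtains d where "d \<in> D" "\<And>x. x \<in> N \<Longrightarrow> d x = t x"
proof -
  define S where "S = {f \<in> topspace (torus W). \<forall>x\<in>N. f x = t x}"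
  have top: "topspace (torus W) = Pi\<^sub>E W (\<lambda>_. sphere 0 1)"
    by (simp add: torus_def circle_top_def)
  have "gdelta_in (torus W) S"
  \<comment> \<open>For empty \<open>N\<close> the family \<open>C\<close> below is empty, and its
    intersection would be the whole type instead of the torus.\<close>
  proof (cases "N = {}")
    case True
    then show ?thesis by (simp add: S_def gdelta_in_topspace)
  next
    case False
    define C where "C = (\<Union>x\<in>N. range (\<lambda>n::nat. {f \<in> topspace (torus W). f x \<in> ball (t x) (1 / Suc n)}))"
    have "f x = t x" if f: "f \<in> \<Inter>C" and x: "x \<in> N" for f x
    proof (rule ccontr)
      assume "f x \<noteq> t x"
      then obtain n where "1 / Suc n < dist (t x) (f x)"
        using nat_approx_posE[of "dist (t x) (f x)"] by (metis zero_less_dist_iff of_nat_Suc)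
      moreover have "f x \<in> ball (t x) (1 / Suc n)"
        using f x unfolding C_def by blast
      ultimately show False by simp
    qed
    moreover have "\<Inter>C \<subseteq> topspace (torus W)" using False unfolding C_def by blast
    moreover have "S \<subseteq> \<Inter>C" unfolding C_def S_def by auto
    ultimately have "S = \<Inter>C" unfolding S_def by blast
    moreover have "gdelta_in (torus W) (\<Inter>C)"
    proof (rule gdelta_in_Inter)
      show "countable C" "C \<noteq> {}" using N False by (auto simp: C_def)
      fix A assume "A \<in> C"
      then obtain x n where A: "x \<in> N" "A = {f \<in> topspace (torus W). f x \<in> ball (t x) (1 / Suc n)}"
        unfolding C_def by blast
      have "continuous_map (torus W) circle_top (\<lambda>f. f x)"
        unfolding torus_def using A(1) N(2) by (intro continuous_map_product_projection) auto
      then have "continuous_map (torus W) euclidean (\<lambda>f. f x)"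
        unfolding circle_top_def continuous_map_in_subtopology by simp
      from openin_continuous_map_preimage[OF this, of "ball (t x) (1 / Suc n)"]
      show "gdelta_in (torus W) A" unfolding A(2) by (intro open_imp_gdelta_in) simp
    qed
    ultimately show ?thesis by simp
  qed
  moreover have "(\<lambda>x\<in>W. if x \<in> N then t x else 1) \<in> S"
    using N t by (auto simp: S_def top)
  ultimately obtain d where "d \<in> S" "d \<in> D"
    using D unfolding gdelta_dense_def by blast
  then show ?thesis using that by (auto simp: S_def)
qed

context comm_group
begin

lemma generate_finite_imp_finprod:
  assumes F: "finite F" "F \<subseteq> carrier G" and g: "g \<in> generate G F"
  obtains m :: "'a \<Rightarrow> int" where "g = finprod G (\<lambda>x. x [^] m x) F"
proof -
  have single: "finprod G (\<lambda>x. x [^] (if x = h then n else 0 :: int)) F = h [^] n" if h: "h \<in> F" for h n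
  proof -
    have "finprod G (\<lambda>x. x [^] (if x = h then n else 0 :: int)) F = finprod G (\<lambda>x. if h = x then x [^] n else \<one>) F"
      by (rule finprod_cong') (use F(2) in auto)
    also have "\<dots> = h [^] n"
      by (rule finprod_singleton) (use F h in auto)
    finally show ?thesis .
  qed
  from g have "\<exists>m :: 'a \<Rightarrow> int. g = finprod G (\<lambda>x. x [^] m x) F"
  proof (induction rule: generate.induct)
    case one
    show ?case by (rule exI[of _ "\<lambda>_. 0"]) simp
  next
    case (incl h)
    then show ?case using single[of h 1] F(2) by (intro exI[of _ "\<lambda>x. if x = h then 1 else 0"]) auto
  next
    case (inv h)
    then show ?case using single[of h "-1"] F(2)
      by (intro exI[of _ "\<lambda>x. if x = h then -1 else 0"]) (auto simp: int_pow_neg)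
  next
    case (eng g h)
    then obtain m n :: "'a \<Rightarrow> int" where "g = finprod G (\<lambda>x. x [^] m x) F" "h = finprod G (\<lambda>x. x [^] n x) F"
      by blast
    moreover have "finprod G (\<lambda>x. x [^] (m x + n x)) F = finprod G (\<lambda>x. x [^] m x \<otimes> x [^] n x) F"
      by (rule finprod_cong') (use F(2) in \<open>auto simp: int_pow_mult\<close>)
    ultimately show ?case
      using F(2) by (intro exI[of _ "\<lambda>x. m x + n x"]) (simp add: finprod_multf Pi_iff subset_iff)
  qed
  then show ?thesis using that by blast
qed

text \<open>By independence no nonzero power of \<open>x\<close> is generated by other members of
  \<open>R\<close>, so the value at a new element is unconstrained. Finite subsets suffice because
  an incoherence has finite support.\<close>

lemma coherent_tf_independent:
  assumes R: "tf_independent G R" and d: "d \<in> R \<rightarrow> sphere 0 1"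
  shows "coherent G d R"
proof -
  have Rc: "R \<subseteq> carrier G" and ind: "\<And>F (m :: 'a \<Rightarrow> int). finite F \<Longrightarrow> F \<subseteq> R \<Longrightarrow>
      finprod G (\<lambda>x. x [^] m x) F = \<one> \<Longrightarrow> \<forall>x\<in>F. m x = 0"
    using R unfolding tf_independent_def by auto
  have fin: "coherent G d F" if "finite F" "F \<subseteq> R" for F
    using that
  proof (induction rule: finite_induct)
    case empty show ?case by (rule coherent_empty)
  next
    case (insert x F)
    have Fc: "F \<subseteq> carrier G" and xc: "x \<in> carrier G" and dF: "d \<in> F \<rightarrow> sphere 0 1"
      and c: "coherent G d F"
      using insert Rc d by auto
    have "coherent G (d(x := d x)) (insert x F)"
    proof (rule coherent_insert[OF Fc dF xc insert(2) c])
      show "d x \<in> sphere 0 1" using d insert by auto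
      fix n :: int and w assume w: "(x [^] n, w) \<in> graph_gen G d F"
      then have "x [^] n \<in> generate G F" by (rule graph_gen_imp_generate[OF _ Fc dF])
      then obtain m :: "'a \<Rightarrow> int" where m: "x [^] n = finprod G (\<lambda>x. x [^] m x) F"
        using generate_finite_imp_finprod[OF insert(1) Fc] by blast
      \<comment> \<open>The exponent \<open>- n\<close> at \<open>x\<close> moves the expression for
        \<open>x [^] n\<close> to one side, giving a relation to which independence applies.\<close>
      have "finprod G (\<lambda>y. y [^] (m(x := - n)) y) (insert x F) =
          x [^] (- n) \<otimes> finprod G (\<lambda>y. y [^] (m(x := - n)) y) F"
        using insert Fc xc by (subst finprod_insert) auto
      also have "finprod G (\<lambda>y. y [^] (m(x := - n)) y) F = finprod G (\<lambda>x. x [^] m x) F"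
        by (rule finprod_cong') (use Fc insert(2) in auto)
      also have "x [^] (- n) \<otimes> finprod G (\<lambda>x. x [^] m x) F = \<one>"
        unfolding m[symmetric] using xc by (simp add: int_pow_neg)
      finally have "\<forall>y\<in>insert x F. (m(x := - n)) y = 0"
        using insert by (intro ind) auto
      then have "n = 0" by simp
      then show "w = d x powi n" using w c by (simp add: coherent_def)
    qed
    then show ?case by simp
  qed
  show ?thesis
    unfolding coherent_def
  proof (intro allI impI)
    fix w assume "(\<one>, w) \<in> graph_gen G d R"
    then obtain F where "finite F" "F \<subseteq> R" "(\<one>, w) \<in> graph_gen G d F"
      by (rule graph_gen_finite_support)
    then show "w = 1" using fin[of F] by (simp add: coherent_def)
  qed
qed

text \<open>A member of \<open>R\<close> supplies a row and hence a point of \<open>G\<close>; a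
  subset of \<open>K\<close> supplies a column and hence a character. To match a character
  \<open>f\<close> on the closed countable set \<open>C\<close>, one column must carry the entries
  of \<open>f\<close> on \<open>C \<inter> R\<close> and at the same time an advice agreeing with
  \<open>f\<close> on \<open>C\<close>. The label \<delta> of the matrix exists for this
  simultaneous choice.\<close>

lemma exists_interpolating_of_rank:
  fixes K :: "'k set"
  assumes R: "tf_independent G R" and K: "infinite K" and KR: "seqs K \<lesssim> R" "R \<lesssim> Pow K"
    and D: "gdelta_dense (torus (carrier G)) D" "D \<lesssim> Pow K"
  shows "\<exists>Y. interpolating G Y"
proof -
  have Rc: "R \<subseteq> carrier G" using R by (simp add: tf_independent_def)
  have Ds: "\<delta> x \<in> sphere 0 1" if "\<delta> \<in> D" "x \<in> carrier G" for \<delta> x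
  proof -
    have "\<delta> \<in> Pi\<^sub>E (carrier G) (\<lambda>_. sphere 0 1)"
      using D(1) that(1) unfolding gdelta_dense_def by (auto simp: torus_def circle_top_def)
    then show ?thesis using that(2) by (rule PiE_mem)
  qed
  have Dne: "D \<noteq> {}"
    using gdelta_dense_extends[OF D(1), of "{}" "\<lambda>_. 1"] by auto
  obtain M :: "'a \<Rightarrow> 'k set \<Rightarrow> complex" and \<delta> :: "'k set \<Rightarrow> 'a \<Rightarrow> complex" where
    M: "\<And>x y. x \<in> R \<Longrightarrow> y \<in> Pow K \<Longrightarrow> M x y \<in> sphere 0 1" and \<delta>: "\<And>y. y \<in> Pow K \<Longrightarrow> \<delta> y \<in> D"
    and row: "\<And>B t. countable B \<Longrightarrow> B \<subseteq> Pow K \<Longrightarrow> t \<in> B \<rightarrow> sphere 0 1 \<Longrightarrow> \<exists>x\<in>R. \<forall>y\<in>B. M x y = t y"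
    and col: "\<And>C t s. countable C \<Longrightarrow> C \<subseteq> R \<Longrightarrow> t \<in> C \<rightarrow> sphere 0 1 \<Longrightarrow> s \<in> D \<Longrightarrow>
       \<exists>y\<in>Pow K. \<delta> y = s \<and> (\<forall>x\<in>C. M x y = t x)"
    by (rule interpolation_matrix[OF K _ _ KR lepoll_trans[OF KR] lepoll_refl D(2) Dne, where V = "sphere 0 1"])
      (simp add: norm_mult; fail | rule that; assumption)+
  obtain s :: "('a \<Rightarrow> complex) \<Rightarrow> 'a \<Rightarrow> complex" where s:
    "\<And>d. d \<in> carrier G \<rightarrow> sphere 0 1 \<Longrightarrow> coherent G d R \<Longrightarrow> s d \<in> hom G circle_group"
    "\<And>d b. d \<in> carrier G \<rightarrow> sphere 0 1 \<Longrightarrow> coherent G d R \<Longrightarrow> b \<in> R \<Longrightarrow> s d b = d b"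
    "\<And>N. countable N \<Longrightarrow> N \<subseteq> carrier G \<Longrightarrow> \<exists>C. countable C \<and> N \<subseteq> C \<and> C \<subseteq> carrier G \<and>
       (\<forall>d f. d \<in> carrier G \<rightarrow> sphere 0 1 \<longrightarrow> coherent G d R \<longrightarrow> f \<in> hom G circle_group \<longrightarrow>
         (\<forall>x\<in>C. d x = f x) \<longrightarrow> (\<forall>x\<in>C. s d x = f x))"
    by (rule character_recursion[OF Rc]) (rule that; assumption)
  define d where "d y x = (if x \<in> R then M x y else \<delta> y x)" for y x
  have d: "d y \<in> carrier G \<rightarrow> sphere 0 1" "coherent G (d y) R" if "y \<in> Pow K" for y
  proof -
    show "d y \<in> carrier G \<rightarrow> sphere 0 1"
      unfolding d_def using M[OF _ that] Ds[OF \<delta>[OF that]] by auto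
    then show "coherent G (d y) R"
      using Rc by (intro coherent_tf_independent[OF R]) auto
  qed
  define c where "c y = s (d y)" for y
  have chom: "c y \<in> hom G circle_group" if "y \<in> Pow K" for y
    unfolding c_def using s(1) d[OF that] by blast
  have cR: "c y x = M x y" if "y \<in> Pow K" "x \<in> R" for y x
    unfolding c_def using s(2)[OF d[OF that(1)] that(2)] that(2) by (simp add: d_def)
  \<comment> \<open>Already the points of \<open>R\<close> attain every value, by the row property
    for a single column, so each range is the full circle.\<close>
  have cim: "c y ` carrier G = sphere 0 1" if y: "y \<in> Pow K" for y
  proof
    show "c y ` carrier G \<subseteq> sphere 0 1" using hom_in_carrier[OF chom[OF y]] by auto
    show "sphere 0 1 \<subseteq> c y ` carrier G"
    proof
      fix v :: complex assume "v \<in> sphere 0 1"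
      then obtain x where "x \<in> R" "M x y = v" using row[of "{y}" "\<lambda>_. v"] y by auto
      then show "v \<in> c y ` carrier G" using cR[OF y] Rc by force
    qed
  qed
  have "interpolating G (c ` Pow K)"
  proof (rule interpolatingI)
    show "y \<in> hom G circle_group" "closed (y ` carrier G)" if "y \<in> c ` Pow K" for y
      using that chom cim by auto
  next
    fix B t assume B: "countable B" "B \<subseteq> c ` Pow K" and t: "\<And>y. y \<in> B \<Longrightarrow> t y \<in> y ` carrier G"
    \<comment> \<open>Different columns may yield the same character; a set of representatives keeps
      the prescription for columns countable and well defined.\<close>
    obtain A where A: "A \<subseteq> Pow K" "inj_on c A" "B = c ` A"
      using B(2) by (meson subset_image_inj)
    have "countable A" using B(1) A(2,3) countable_image_inj_on by blast
    moreover have "t (c y) \<in> sphere 0 1" if "y \<in> A" for y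
    proof -
      have "y \<in> Pow K" using A(1) that by (rule subsetD)
      moreover have "t (c y) \<in> c y ` carrier G" using A(3) that by (intro t) simp
      ultimately show ?thesis by (simp only: cim)
    qed
    then have "t \<circ> c \<in> A \<rightarrow> sphere 0 1" by simp
    ultimately obtain x where "x \<in> R" "\<forall>y\<in>A. M x y = (t \<circ> c) y"
      using row[OF _ A(1)] by metis
    then show "\<exists>g\<in>carrier G. \<forall>y\<in>B. y g = t y"
      unfolding A(3) using cR[OF subsetD[OF A(1)]] Rc by (intro bexI[of _ x]) auto
  next
    fix N f assume N: "countable N" "N \<subseteq> carrier G" and f: "f \<in> hom G circle_group"
    obtain C where C: "countable C" "N \<subseteq> C" "C \<subseteq> carrier G" and Cs:
       "\<forall>d f. d \<in> carrier G \<rightarrow> sphere 0 1 \<longrightarrow> coherent G d R \<longrightarrow> f \<in> hom G circle_group \<longrightarrow>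
         (\<forall>x\<in>C. d x = f x) \<longrightarrow> (\<forall>x\<in>C. s d x = f x)"
      using s(3)[OF N] by (elim exE conjE)
    have fs: "f \<in> A \<rightarrow> sphere 0 1" if "A \<subseteq> carrier G" for A
      using hom_in_carrier[OF f] that by auto
    obtain e where e: "e \<in> D" "\<And>x. x \<in> C \<Longrightarrow> e x = f x"
      using gdelta_dense_extends[OF D(1) C(1,3) fs[OF C(3)]] by metis
    obtain y where y: "y \<in> Pow K" "\<delta> y = e" "\<forall>x\<in>C \<inter> R. M x y = f x"
      using col[of "C \<inter> R" f e] C(1) fs[of "C \<inter> R"] Rc e(1) by auto
    have "\<forall>x\<in>C. d y x = f x" using y e(2) by (simp add: d_def)
    then have "\<forall>x\<in>C. c y x = f x"
      unfolding c_def by (intro Cs[rule_format] ballI d[OF y(1)] f) simp_all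
    then show "\<exists>ys. set ys \<subseteq> c ` Pow K \<and> (\<forall>x\<in>N. f x = (\<Prod>y\<leftarrow>ys. y x))"
      using y(1) C(2) by (intro exI[of _ "[c y]"]) auto
  qed
  then show ?thesis by blast
qed

end

section \<open>Direct sums of finite cyclic groups\<close>

abbreviation Zsum :: "nat \<Rightarrow> 'i set \<Rightarrow> ('i \<Rightarrow> int) monoid" where
  "Zsum q I \<equiv> sum_group I (\<lambda>_. integer_mod_group q)"

text \<open>For q-th roots of unity \<open>v i\<close>, this is the character of
  \<open>Zsum q I\<close> with value \<open>v i\<close> at the i-th generator.\<close>

definition Zsum_char :: "'i set \<Rightarrow> ('i \<Rightarrow> complex) \<Rightarrow> ('i \<Rightarrow> int) \<Rightarrow> complex" where
  "Zsum_char I v f = (\<Prod>i\<in>{i \<in> I. f i \<noteq> 0}. v i powi f i)"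

definition Zsum_unit :: "nat \<Rightarrow> 'i set \<Rightarrow> 'i \<Rightarrow> nat \<Rightarrow> 'i \<Rightarrow> int" where
  "Zsum_unit q I i n = (\<lambda>k\<in>I. if k = i then int n mod int q else 0)"

lemma carrier_Zsum:
  assumes "q > 0"
  shows "f \<in> carrier (Zsum q I) \<longleftrightarrow> f \<in> Pi\<^sub>E I (\<lambda>_. {0..<int q}) \<and> finite {i \<in> I. f i \<noteq> 0}"
  using assms by (simp add: carrier_sum_group carrier_integer_mod_group)

lemma root_of_unity_norm:
  assumes "v ^ q = (1 :: complex)" "q > 0"
  shows "norm v = 1" "v \<noteq> 0"
proof -
  have "norm v ^ q = 1" using assms(1) by (metis norm_one norm_power)
  then show "norm v = 1" using assms(2) power_eq_imp_eq_base[of "norm v" q 1] by simp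
  then show "v \<noteq> 0" by auto
qed

text \<open>Addition in \<open>Zsum\<close> reduces exponents modulo \<open>q\<close>; this makes
  the reduction invisible to characters.\<close>

lemma powi_mod_root_of_unity:
  assumes "v ^ q = (1 :: complex)" "q > 0"
  shows "v powi (n mod int q) = v powi n"
proof -
  have "v \<noteq> 0" using assms by (rule root_of_unity_norm)
  have "v powi n = v powi (int q * (n div int q) + n mod int q)" by simp
  also have "\<dots> = v powi (n mod int q)"
    using \<open>v \<noteq> 0\<close> assms by (subst power_int_add) (simp_all add: power_int_mult)
  finally show ?thesis by simp
qed

lemma Zsum_char_superset:
  assumes "finite U" "{i \<in> I. f i \<noteq> 0} \<subseteq> U" "U \<subseteq> I"
  shows "Zsum_char I v f = (\<Prod>i\<in>U. v i powi f i)"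
  unfolding Zsum_char_def by (rule prod.mono_neutral_left) (use assms in auto)

lemma Zsum_char_hom:
  assumes q: "q > 0" and v: "\<And>i. i \<in> I \<Longrightarrow> v i ^ q = 1"
  shows "Zsum_char I v \<in> hom (Zsum q I) circle_group"
proof (rule homI)
  have v0: "v i \<noteq> 0" if "i \<in> I" for i using v[OF that] q by (rule root_of_unity_norm)
  have v1: "norm (v i) = 1" if "i \<in> I" for i
    using v[OF that] q by (rule root_of_unity_norm)
  show "Zsum_char I v f \<in> carrier circle_group" for f
  proof -
    have "norm (Zsum_char I v f) = (\<Prod>i\<in>{i \<in> I. f i \<noteq> 0}. norm (v i) powi f i)"
      unfolding Zsum_char_def prod_norm[symmetric] norm_power_int ..
    also have "\<dots> = 1" by (rule prod.neutral) (simp add: v1)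
    finally show ?thesis by simp
  qed
  fix f g assume "f \<in> carrier (Zsum q I)" "g \<in> carrier (Zsum q I)"
  then have fin: "finite {i \<in> I. f i \<noteq> 0}" "finite {i \<in> I. g i \<noteq> 0}"
    using q by (auto simp: carrier_Zsum)
  define U where "U = {i \<in> I. f i \<noteq> 0} \<union> {i \<in> I. g i \<noteq> 0}"
  have U: "finite U" "U \<subseteq> I" using fin by (auto simp: U_def)
  let ?h = "f \<otimes>\<^bsub>Zsum q I\<^esub> g"
  have "Zsum_char I v ?h = (\<Prod>i\<in>U. v i powi ?h i)"
    by (rule Zsum_char_superset) (use U in \<open>auto simp: U_def\<close>)
  also have "\<dots> = (\<Prod>i\<in>U. v i powi f i * v i powi g i)"
  proof (rule prod.cong)
    fix i assume "i \<in> U"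
    then have i: "i \<in> I" using U by auto
    then show "v i powi ?h i = v i powi f i * v i powi g i"
      using powi_mod_root_of_unity[OF v[OF i] q] v0[OF i] by (simp add: power_int_add)
  qed simp
  also have "\<dots> = Zsum_char I v f * Zsum_char I v g"
    using Zsum_char_superset[OF U(1) _ U(2)] by (simp add: prod.distrib U_def)
  finally show "Zsum_char I v ?h = Zsum_char I v f \<otimes>\<^bsub>circle_group\<^esub> Zsum_char I v g" by simp
qed

lemma Zsum_char_root_of_unity:
  assumes "\<And>i. i \<in> I \<Longrightarrow> v i ^ q = 1"
  shows "Zsum_char I v f ^ q = 1"
proof -
  have "(v i powi f i) ^ q = 1" if "i \<in> I" for i
  proof -
    have "(v i powi f i) ^ q = v i powi (f i * int q)" by (simp add: power_int_mult)
    also have "\<dots> = (v i ^ q) powi f i" by (simp add: power_int_mult mult.commute[of "f i"])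
    finally show ?thesis using assms[OF that] by simp
  qed
  then show ?thesis by (simp add: Zsum_char_def prod_power_distrib)
qed

lemma Zsum_unit_carrier: "q > 0 \<Longrightarrow> i \<in> I \<Longrightarrow> Zsum_unit q I i n \<in> carrier (Zsum q I)"
  by (auto simp: carrier_Zsum Zsum_unit_def intro: finite_subset[of _ "{i}"])

lemma Zsum_unit_add:
  "Zsum_unit q I i (m + n) = Zsum_unit q I i m \<otimes>\<^bsub>Zsum q I\<^esub> Zsum_unit q I i n"
  by (auto simp: Zsum_unit_def fun_eq_iff mod_add_eq)

lemma Zsum_char_unit:
  assumes "q > 1" "i \<in> I"
  shows "Zsum_char I v (Zsum_unit q I i 1) = v i"
proof -
  have "{k \<in> I. Zsum_unit q I i 1 k \<noteq> 0} = {i}"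
    using assms by (auto simp: Zsum_unit_def)
  then show ?thesis using assms by (simp add: Zsum_char_def Zsum_unit_def)
qed

lemma hom_Zsum_unit:
  assumes q: "q > 0" and f: "f \<in> hom (Zsum q I) circle_group" and i: "i \<in> I"
  shows "f (Zsum_unit q I i n) = f (Zsum_unit q I i 1) ^ n"
proof (induction n)
  case 0
  have e: "Zsum_unit q I i 0 = \<one>\<^bsub>Zsum q I\<^esub>" by (auto simp: Zsum_unit_def fun_eq_iff)
  have "f \<one>\<^bsub>Zsum q I\<^esub> = \<one>\<^bsub>circle_group\<^esub>"
    by (rule hom_one[OF f _ group_circle]) simp
  then show ?case by (simp only: e power_0 one_circle)
next
  case (Suc n)
  have "f (Zsum_unit q I i (n + 1)) = f (Zsum_unit q I i n) * f (Zsum_unit q I i 1)"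
    unfolding Zsum_unit_add
    using hom_mult[OF f Zsum_unit_carrier[OF q i, of n] Zsum_unit_carrier[OF q i, of 1]]
    unfolding mult_circle .
  then show ?case
    by (simp only: Suc_eq_plus1 Suc.IH power_add power_one_right)
qed

lemma hom_Zsum_unit_root:
  assumes q: "q > 0" and f: "f \<in> hom (Zsum q I) circle_group" and i: "i \<in> I"
  shows "f (Zsum_unit q I i 1) ^ q = 1"
proof -
  have "Zsum_unit q I i q = \<one>\<^bsub>Zsum q I\<^esub>" by (auto simp: Zsum_unit_def fun_eq_iff)
  then show ?thesis using hom_Zsum_unit[OF assms, of q] hom_one[OF f _ group_circle] by simp
qed

text \<open>Induction over a finite set containing the support: one coordinate is split off as a
  multiple of its generator, the rest of the element being \<open>x(a := 0)\<close>.\<close>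

lemma hom_Zsum_eq_char:
  assumes q: "q > 0" and f: "f \<in> hom (Zsum q I) circle_group" and x: "x \<in> carrier (Zsum q I)"
  shows "f x = Zsum_char I (\<lambda>i. f (Zsum_unit q I i 1)) x"
proof -
  have "\<forall>x\<in>carrier (Zsum q I). {i \<in> I. x i \<noteq> 0} \<subseteq> U \<longrightarrow> f x = (\<Prod>i\<in>U. f (Zsum_unit q I i 1) powi x i)"
    if "finite U" "U \<subseteq> I" for U
    using that
  proof (induction rule: finite_induct)
    case empty
    show ?case
    proof (intro ballI impI)
      fix x assume "x \<in> carrier (Zsum q I)" "{i \<in> I. x i \<noteq> 0} \<subseteq> {}"
      then have "x = \<one>\<^bsub>Zsum q I\<^esub>" using q by (auto simp: carrier_Zsum fun_eq_iff PiE_iff extensional_def)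
      then show "f x = (\<Prod>i\<in>{}. f (Zsum_unit q I i 1) powi x i)"
        using hom_one[OF f _ group_circle] by simp
    qed
  next
    case (insert a U)
    show ?case
    proof (intro ballI impI)
      fix x assume x: "x \<in> carrier (Zsum q I)" "{i \<in> I. x i \<noteq> 0} \<subseteq> insert a U"
      have a: "a \<in> I" and UI: "U \<subseteq> I" using insert by auto
      have xP: "x \<in> Pi\<^sub>E I (\<lambda>_. {0..<int q})" using x(1) q by (simp add: carrier_Zsum)
      then have xa: "0 \<le> x a" "x a < int q" using a by (auto simp: PiE_iff)
      have xx: "x(a := 0) \<in> carrier (Zsum q I)"
        using xP a q x(2) insert(1) by (auto simp: carrier_Zsum PiE_iff extensional_def intro: finite_subset[of _ U])
      have "x = x(a := 0) \<otimes>\<^bsub>Zsum q I\<^esub> Zsum_unit q I a (nat (x a))"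
        using xP a xa by (auto simp: fun_eq_iff Zsum_unit_def PiE_iff extensional_def)
      then have "f x = f (x(a := 0)) * f (Zsum_unit q I a (nat (x a)))"
        using hom_mult[OF f xx Zsum_unit_carrier[OF q a, of "nat (x a)"]] by simp
      also have "f (x(a := 0)) = (\<Prod>i\<in>U. f (Zsum_unit q I i 1) powi (x(a := 0)) i)"
      proof -
        have "{i \<in> I. (x(a := 0)) i \<noteq> 0} \<subseteq> U" using x(2) by auto
        then show ?thesis using insert.IH[OF UI, rule_format, OF xx] by simp
      qed
      also have "\<dots> = (\<Prod>i\<in>U. f (Zsum_unit q I i 1) powi x i)"
        by (rule prod.cong) (use insert(2) in auto)
      also have "f (Zsum_unit q I a (nat (x a))) = f (Zsum_unit q I a 1) powi x a"
        using hom_Zsum_unit[OF q f a, of "nat (x a)"] xa by (simp add: power_int_def)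
      finally show "f x = (\<Prod>i\<in>insert a U. f (Zsum_unit q I i 1) powi x i)"
        using insert by (simp add: mult.commute)
    qed
  qed
  from this[of "{i \<in> I. x i \<noteq> 0}"] x q show ?thesis
    by (simp add: Zsum_char_def carrier_Zsum)
qed

text \<open>The index set \<open>I\<close> serves for both rows and columns: row \<open>x\<close> is
  realised by the x-th generator, column \<open>y\<close> by the character with values
  \<open>M x y\<close> on the generators. The entries are q-th roots of unity, which impose no
  further condition on a character.\<close>

lemma exists_interpolating_Zsum:
  fixes K :: "'k set" and I :: "'i set"
  assumes q: "q > 1" and K: "infinite K" and KI: "seqs K \<lesssim> I" "I \<lesssim> Pow K"
  shows "\<exists>Y. interpolating (Zsum q I) Y"
proof -
  define V where "V = {z :: complex. z ^ q = 1}"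
  have finV: "finite V" unfolding V_def using q by (intro finite_roots_unity) auto
  have V1: "1 \<in> V" and Vm: "\<And>u v. u \<in> V \<Longrightarrow> v \<in> V \<Longrightarrow> u * v \<in> V"
    by (auto simp: V_def power_mult_distrib)
  have "seqs K \<noteq> {}" using K by (auto simp: Pi_eq_empty)
  then have "I \<noteq> {}" using KI(1) by auto
  then obtain i0 where "i0 \<in> I" by blast
  \<comment> \<open>Columns need no advice here, so the label set is a singleton.\<close>
  then have unit: "{()} \<lesssim> I" unfolding lepoll_def by (intro exI[of _ "\<lambda>_. i0"]) auto
  obtain M :: "'i \<Rightarrow> 'i \<Rightarrow> complex" and \<delta> :: "'i \<Rightarrow> unit" where
    M: "\<And>x y. x \<in> I \<Longrightarrow> y \<in> I \<Longrightarrow> M x y \<in> V" and \<delta>: "\<And>y. y \<in> I \<Longrightarrow> \<delta> y \<in> {()}"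
    and row: "\<And>B t. countable B \<Longrightarrow> B \<subseteq> I \<Longrightarrow> t \<in> B \<rightarrow> V \<Longrightarrow> \<exists>x\<in>I. \<forall>y\<in>B. M x y = t y"
    and col: "\<And>C t s. countable C \<Longrightarrow> C \<subseteq> I \<Longrightarrow> t \<in> C \<rightarrow> V \<Longrightarrow> s \<in> {()} \<Longrightarrow>
       \<exists>y\<in>I. \<delta> y = s \<and> (\<forall>x\<in>C. M x y = t x)"
    by (rule interpolation_matrix[OF K V1 Vm KI KI unit]) (assumption | simp; fail | rule that; assumption)+
  define c where "c y = Zsum_char I (\<lambda>x. M x y)" for y
  have Mq: "M x y ^ q = 1" if "x \<in> I" "y \<in> I" for x y using M[OF that] by (simp add: V_def)
  have cV: "c y ` carrier (Zsum q I) \<subseteq> V" if "y \<in> I" for y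
    using Zsum_char_root_of_unity[OF Mq[OF _ that]] by (auto simp: c_def V_def)
  have q0: "q > 0" using q by simp
  have cu: "c y (Zsum_unit q I x 1) = M x y" if "x \<in> I" for x y
    unfolding c_def using Zsum_char_unit[OF q that] .
  have "interpolating (Zsum q I) (c ` I)"
  proof (rule interpolatingI)
    fix y assume "y \<in> c ` I"
    then obtain j where j: "j \<in> I" "y = c j" by blast
    show "y \<in> hom (Zsum q I) circle_group"
      unfolding j(2) c_def by (rule Zsum_char_hom[OF q0 Mq[OF _ j(1)]])
    show "closed (y ` carrier (Zsum q I))"
      unfolding j(2) using finite_subset[OF cV[OF j(1)] finV] by (rule finite_imp_closed)
  next
    fix B t assume B: "countable B" "B \<subseteq> c ` I" and t: "\<And>y. y \<in> B \<Longrightarrow> t y \<in> y ` carrier (Zsum q I)"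
    obtain A where A: "A \<subseteq> I" "inj_on c A" "B = c ` A"
      using B(2) by (meson subset_image_inj)
    have "countable A" using B(1) A(2,3) countable_image_inj_on by blast
    moreover have "t \<circ> c \<in> A \<rightarrow> V"
    proof
      fix y assume y: "y \<in> A"
      then have "t (c y) \<in> c y ` carrier (Zsum q I)" using A(3) by (intro t) simp
      then show "(t \<circ> c) y \<in> V" using cV[of y] A(1) y by auto
    qed
    ultimately obtain x where x: "x \<in> I" "\<forall>y\<in>A. M x y = (t \<circ> c) y"
      using row[OF _ A(1)] by metis
    then show "\<exists>g\<in>carrier (Zsum q I). \<forall>y\<in>B. y g = t y"
      unfolding A(3) using cu[OF x(1)] Zsum_unit_carrier[OF q0 x(1), of 1]
      by (intro bexI[of _ "Zsum_unit q I x 1"]) simp_all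
  next
    fix N f assume N: "countable N" "N \<subseteq> carrier (Zsum q I)" and f: "f \<in> hom (Zsum q I) circle_group"
    \<comment> \<open>Elements have finite support, so a character on the countable set
      \<open>N\<close> depends on countably many generators only.\<close>
    define C where "C = (\<Union>x\<in>N. {i \<in> I. x i \<noteq> 0})"
    have C: "countable C" "C \<subseteq> I"
    proof -
      have "finite {i \<in> I. x i \<noteq> 0}" if "x \<in> N" for x
        using subsetD[OF N(2) that] q0 by (simp add: carrier_Zsum)
      then show "countable C" unfolding C_def by (intro countable_UN N(1) countable_finite)
    qed (auto simp: C_def)
    have "(\<lambda>i. f (Zsum_unit q I i 1)) \<in> C \<rightarrow> V"
      using hom_Zsum_unit_root[OF q0 f] C(2) by (auto simp: V_def)
    then obtain j where j: "j \<in> I" "\<forall>x\<in>C. M x j = f (Zsum_unit q I x 1)"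
      using col[OF C, of _ "()"] by blast
    have "f x = c j x" if "x \<in> N" for x
    proof -
      have "f x = Zsum_char I (\<lambda>i. f (Zsum_unit q I i 1)) x"
        using hom_Zsum_eq_char[OF q0 f subsetD[OF N(2) that]] .
      also have "\<dots> = c j x"
        unfolding c_def Zsum_char_def by (rule prod.cong) (use j(2) that in \<open>auto simp: C_def\<close>)
      finally show ?thesis .
    qed
    then show "\<exists>ys. set ys \<subseteq> c ` I \<and> (\<forall>x\<in>N. f x = (\<Prod>y\<leftarrow>ys. y x))"
      using j(1) by (intro exI[of _ "[c j]"]) auto
  qed
  then show ?thesis by blast
qed

section \<open>The decomposition\<close>

lemma comm_group_sum_group:
  assumes "\<And>i. i \<in> I \<Longrightarrow> comm_group (S i)"
  shows "comm_group (sum_group I S)"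
proof -
  have g: "group (S i)" if "i \<in> I" for i using assms[OF that] by (simp add: comm_group_def)
  show ?thesis
  proof (rule group.group_comm_groupI)
    show "group (sum_group I S)" using g by simp
    fix x y assume "x \<in> carrier (sum_group I S)" "y \<in> carrier (sum_group I S)"
    then have "x i \<in> carrier (S i)" "y i \<in> carrier (S i)" if "i \<in> I" for i
      using that by (auto simp: carrier_sum_group[OF g] PiE_iff)
    then show "x \<otimes>\<^bsub>sum_group I S\<^esub> y = y \<otimes>\<^bsub>sum_group I S\<^esub> x"
      using assms by (auto simp: comm_groupE(4) intro!: restrict_ext)
  qed
qed

lemma restrict_in_sum_group:
  assumes S: "\<And>i. i \<in> I \<Longrightarrow> group (S i)" and "A \<subseteq> I" and f: "f \<in> carrier (sum_group I S)"
  shows "restrict f A \<in> carrier (sum_group A S)"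
proof -
  have "\<And>i. i \<in> A \<Longrightarrow> group (S i)" using assms by blast
  moreover have "finite {i \<in> I. f i \<noteq> \<one>\<^bsub>S i\<^esub>}" "f \<in> (\<Pi>\<^sub>E i\<in>I. carrier (S i))"
    using f by (auto simp: carrier_sum_group[OF S])
  moreover from this(1) have "finite {i \<in> A. restrict f A i \<noteq> \<one>\<^bsub>S i\<^esub>}"
    by (rule finite_subset[rotated]) (use assms(2) in auto)
  ultimately show ?thesis using assms(2) by (auto simp: carrier_sum_group)
qed

lemma restrict_sum_group_hom:
  assumes S: "\<And>i. i \<in> I \<Longrightarrow> group (S i)" and "A \<subseteq> I"
  shows "(\<lambda>f. restrict f A) \<in> hom (sum_group I S) (sum_group A S)"
proof (rule homI)
  fix f g
  show "restrict (f \<otimes>\<^bsub>sum_group I S\<^esub> g) A = restrict f A \<otimes>\<^bsub>sum_group A S\<^esub> restrict g A"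
    using assms(2) by (auto simp: fun_eq_iff)
qed (rule restrict_in_sum_group[OF assms])

lemma sum_group_Un_iso:
  assumes S: "\<And>i. i \<in> A \<union> B \<Longrightarrow> group (S i)" and AB: "A \<inter> B = {}"
  shows "(\<lambda>f. (restrict f A, restrict f B)) \<in> iso (sum_group (A \<union> B) S) (sum_group A S \<times>\<times> sum_group B S)"
proof (rule isoI)
  let ?h = "\<lambda>f. (restrict f A, restrict f B)"
  have sub: "A \<subseteq> A \<union> B" "B \<subseteq> A \<union> B" by auto
  have SA: "\<And>i. i \<in> A \<Longrightarrow> group (S i)" and SB: "\<And>i. i \<in> B \<Longrightarrow> group (S i)" using S by auto
  have car: "carrier (sum_group (A \<union> B) S) =
      {x \<in> \<Pi>\<^sub>E i\<in>A \<union> B. carrier (S i). finite {i \<in> A \<union> B. x i \<noteq> \<one>\<^bsub>S i\<^esub>}}"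
    by (rule carrier_sum_group) (rule S)
  show "?h \<in> hom (sum_group (A \<union> B) S) (sum_group A S \<times>\<times> sum_group B S)"
    unfolding hom_pairwise
    using restrict_sum_group_hom[OF S sub(1)] restrict_sum_group_hom[OF S sub(2)] by (simp add: o_def)
  show "bij_betw ?h (carrier (sum_group (A \<union> B) S)) (carrier (sum_group A S \<times>\<times> sum_group B S))"
    unfolding bij_betw_def
  proof
    show "inj_on ?h (carrier (sum_group (A \<union> B) S))"
    proof (rule inj_onI)
      fix f g assume f: "f \<in> carrier (sum_group (A \<union> B) S)" and g: "g \<in> carrier (sum_group (A \<union> B) S)"
        and e: "?h f = ?h g"
      have fe: "f \<in> extensional (A \<union> B)" "g \<in> extensional (A \<union> B)"
        using f g unfolding car by (simp_all add: PiE_iff)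
      show "f = g"
      proof (rule extensionalityI[OF fe])
        fix i assume "i \<in> A \<union> B"
        then show "f i = g i"
          using e by (metis Pair_inject UnE restrict_apply')
      qed
    qed
    show "?h ` carrier (sum_group (A \<union> B) S) = carrier (sum_group A S \<times>\<times> sum_group B S)"
    proof
      show "?h ` carrier (sum_group (A \<union> B) S) \<subseteq> carrier (sum_group A S \<times>\<times> sum_group B S)"
        using restrict_in_sum_group[OF S sub(1)] restrict_in_sum_group[OF S sub(2)] by auto
      show "carrier (sum_group A S \<times>\<times> sum_group B S) \<subseteq> ?h ` carrier (sum_group (A \<union> B) S)"
      proof
        fix p assume "p \<in> carrier (sum_group A S \<times>\<times> sum_group B S)"
        then obtain f g where p: "p = (f, g)" and f: "f \<in> carrier (sum_group A S)" and g: "g \<in> carrier (sum_group B S)"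
          by auto
        have f': "f \<in> (\<Pi>\<^sub>E i\<in>A. carrier (S i))" "finite {i \<in> A. f i \<noteq> \<one>\<^bsub>S i\<^esub>}"
          and g': "g \<in> (\<Pi>\<^sub>E i\<in>B. carrier (S i))" "finite {i \<in> B. g i \<noteq> \<one>\<^bsub>S i\<^esub>}"
          using f g by (auto simp: carrier_sum_group[OF SA] carrier_sum_group[OF SB])
        define u where "u = (\<lambda>i\<in>A \<union> B. if i \<in> A then f i else g i)"
        have "{i \<in> A \<union> B. u i \<noteq> \<one>\<^bsub>S i\<^esub>} \<subseteq> {i \<in> A. f i \<noteq> \<one>\<^bsub>S i\<^esub>} \<union> {i \<in> B. g i \<noteq> \<one>\<^bsub>S i\<^esub>}"
          by (auto simp: u_def)
        then have "finite {i \<in> A \<union> B. u i \<noteq> \<one>\<^bsub>S i\<^esub>}"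
          using f'(2) g'(2) by (meson finite_UnI finite_subset)
        moreover have "u \<in> (\<Pi>\<^sub>E i\<in>A \<union> B. carrier (S i))"
          using f'(1) g'(1) by (auto simp: u_def PiE_iff)
        ultimately have "u \<in> carrier (sum_group (A \<union> B) S)" unfolding car by simp
        moreover have "restrict u A = f"
          using f'(1) by (auto simp: u_def fun_eq_iff PiE_iff extensional_def)
        moreover have "restrict u B = g"
          using g'(1) AB by (auto simp: u_def fun_eq_iff PiE_iff extensional_def)
        ultimately show "p \<in> ?h ` carrier (sum_group (A \<union> B) S)" using p by auto
      qed
    qed
  qed
qed

lemma sum_group_singleton_iso:
  assumes S: "group (S a)"
  shows "(\<lambda>f. f a) \<in> iso (sum_group {a} S) (S a)"
proof (rule isoI)
  have c: "carrier (sum_group {a} S) = (\<Pi>\<^sub>E i\<in>{a}. carrier (S i))"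
    using S by (subst carrier_sum_group) auto
  show "(\<lambda>f. f a) \<in> hom (sum_group {a} S) (S a)"
    by (rule homI) (auto simp: c)
  show "bij_betw (\<lambda>f. f a) (carrier (sum_group {a} S)) (carrier (S a))"
    unfolding c
  proof (rule bij_betw_byWitness[where f' = "\<lambda>x. \<lambda>i\<in>{a}. x"])
    show "\<forall>f\<in>\<Pi>\<^sub>E i\<in>{a}. carrier (S i). (\<lambda>i\<in>{a}. f a) = f"
      by (auto simp: fun_eq_iff PiE_iff extensional_def)
    show "(\<lambda>x. \<lambda>i\<in>{a}. x) ` carrier (S a) \<subseteq> (\<Pi>\<^sub>E i\<in>{a}. carrier (S i))"
      by (rule image_subsetI) (simp add: PiE_iff)
  qed auto
qed

lemma pow_sum_group:
  "x \<in> carrier (sum_group I S) \<Longrightarrow> (\<And>i. i \<in> I \<Longrightarrow> group (S i)) \<Longrightarrow>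
    x [^]\<^bsub>sum_group I S\<^esub> (n::nat) = (\<lambda>i\<in>I. x i [^]\<^bsub>S i\<^esub> n)"
proof (induction n)
  case 0
  then show ?case
    by (simp add: group.is_monoid monoid.nat_pow_0 cong: restrict_cong)
next
  case (Suc n)
  interpret group "sum_group I S" using Suc by simp
  show ?case
    using Suc by (auto simp: fun_eq_iff group.is_monoid monoid.nat_pow_Suc)
qed

lemma interpolating_is_iso:
  assumes "group G" "group H" "G \<cong> H" "\<exists>Y. interpolating H Y"
  shows "\<exists>Y. interpolating G Y"
  using assms interpolating_iso[OF assms(1,2)] unfolding is_iso_def by blast

lemma exists_interpolating_DirProd:
  assumes "group G" "group H" "\<exists>Y. interpolating G Y" "\<exists>Y. interpolating H Y"
  shows "\<exists>Y. interpolating (G \<times>\<times> H) Y"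
  using interpolating_DirProd[OF assms(1,2)] assms(3,4) by blast

lemma exists_interpolating_finite_sum:
  assumes "finite P" "\<And>q. q \<in> P \<Longrightarrow> group (S q)" "\<And>q. q \<in> P \<Longrightarrow> \<exists>Y. interpolating (S q) Y"
  shows "\<exists>Y. interpolating (sum_group P S) Y"
  using assms
proof (induction rule: finite_induct)
  case empty
  have "carrier (sum_group {} S) = {\<one>\<^bsub>sum_group {} S\<^esub>}"
    by (subst carrier_sum_group) (auto simp: restrict_def fun_eq_iff)
  then show ?case by (intro exI[of _ "{}"] interpolating_trivial sum_group) simp_all
next
  case (insert q P)
  have Sq: "group (S q)" and SP: "\<And>i. i \<in> P \<Longrightarrow> group (S i)" and SqP: "\<And>i. i \<in> {q} \<union> P \<Longrightarrow> group (S i)"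
    using insert.prems(1) by auto
  have gq: "group (sum_group {q} S)"
    by (rule sum_group) (use Sq in auto)
  have gP: "group (sum_group P S)"
    by (rule sum_group) (rule SP)
  have gqP: "group (sum_group ({q} \<union> P) S)"
    by (rule sum_group) (rule SqP)
  have "\<exists>Y. interpolating (sum_group {q} S) Y"
    by (rule interpolating_is_iso[OF gq Sq is_isoI[OF sum_group_singleton_iso[where S = S, OF Sq]]]) (simp add: insert.prems)
  moreover have "\<exists>Y. interpolating (sum_group P S) Y"
    using insert by simp
  ultimately have "\<exists>Y. interpolating (sum_group {q} S \<times>\<times> sum_group P S) Y"
    by (rule exists_interpolating_DirProd[OF gq gP])
  moreover have "sum_group ({q} \<union> P) S \<cong> sum_group {q} S \<times>\<times> sum_group P S"
    by (rule is_isoI[OF sum_group_Un_iso[OF SqP]]) (use insert.hyps in auto)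
  ultimately show ?case
    using interpolating_is_iso[OF gqP DirProd_group[OF gq gP]] by simp
qed

section \<open>Independence modulo torsion, and assembly of the pieces\<close>

lemma hom_finprod:
  assumes G: "comm_group G" and H: "comm_group H" and h: "h \<in> hom G H" and f: "f \<in> F \<rightarrow> carrier G" and F: "finite F"
  shows "h (finprod G f F) = finprod H (\<lambda>x. h (f x)) F"
proof -
  interpret G: comm_group G by fact
  interpret H: comm_group H by fact
  show ?thesis
    using F f
  proof (induction rule: finite_induct)
    case empty
    then show ?case using hom_one[OF h G.is_group H.is_group] by simp
  next
    case (insert x F)
    have fc: "f x \<in> carrier G" "f \<in> F \<rightarrow> carrier G" using insert by auto
    moreover have "(\<lambda>x. h (f x)) \<in> F \<rightarrow> carrier H" "h (f x) \<in> carrier H"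
      using hom_in_carrier[OF h] fc by auto
    ultimately show ?case
      using insert hom_mult[OF h fc(1) G.finprod_closed[OF fc(2)]] by simp
  qed
qed

text \<open>The kernel has exponent dividing \<open>n\<close>, so a relation among images becomes a
  relation in \<open>G\<close> after raising it to the power \<open>n\<close>, which multiplies all
  coefficients by a nonzero integer. This transports an independent set of \<open>G\<close> to the
  quotient by a bounded part.\<close>

lemma tf_independent_image:
  assumes G: "comm_group G" and L: "comm_group L" and h: "h \<in> hom G L" and n: "n > (0::int)"
    and ker: "\<And>g. g \<in> carrier G \<Longrightarrow> h g = \<one>\<^bsub>L\<^esub> \<Longrightarrow> g [^]\<^bsub>G\<^esub> n = \<one>\<^bsub>G\<^esub>"
    and R: "tf_independent G R"
  shows "inj_on h R" "tf_independent L (h ` R)"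
proof -
  interpret G: comm_group G by fact
  interpret L: comm_group L by fact
  interpret H: group_hom G L h by unfold_locales (rule h)
  have Rc: "R \<subseteq> carrier G" and ind: "\<And>F (m :: _ \<Rightarrow> int). finite F \<Longrightarrow> F \<subseteq> R \<Longrightarrow>
      finprod G (\<lambda>x. x [^]\<^bsub>G\<^esub> m x) F = \<one>\<^bsub>G\<^esub> \<Longrightarrow> \<forall>x\<in>F. m x = 0"
    using R unfolding tf_independent_def by auto
  have key: "m x = 0" if F: "finite F" "F \<subseteq> R" and e: "finprod L (\<lambda>x. h x [^]\<^bsub>L\<^esub> m x) F = \<one>\<^bsub>L\<^esub>" and x: "x \<in> F"
    for F x and m :: "_ \<Rightarrow> int"
  proof -
    have Fc: "F \<subseteq> carrier G" using F Rc by blast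
    have mc: "(\<lambda>x. x [^]\<^bsub>G\<^esub> m x) \<in> F \<rightarrow> carrier G" using Fc by auto
    have "h (finprod G (\<lambda>x. x [^]\<^bsub>G\<^esub> m x) F) = finprod L (\<lambda>x. h (x [^]\<^bsub>G\<^esub> m x)) F"
      by (rule hom_finprod[OF G L h mc F(1)])
    also have "\<dots> = finprod L (\<lambda>x. h x [^]\<^bsub>L\<^esub> m x) F"
      by (rule L.finprod_cong') (use Fc H.hom_int_pow in auto)
    finally have "h (finprod G (\<lambda>x. x [^]\<^bsub>G\<^esub> m x) F) = \<one>\<^bsub>L\<^esub>" using e by simp
    then have "finprod G (\<lambda>x. x [^]\<^bsub>G\<^esub> m x) F [^]\<^bsub>G\<^esub> n = \<one>\<^bsub>G\<^esub>"
      by (rule ker[OF G.finprod_closed[OF mc]])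
    moreover have "(\<lambda>g. g [^]\<^bsub>G\<^esub> n) \<in> hom G G"
      by (rule homI) (auto simp: G.int_pow_distrib)
    from hom_finprod[OF G G this mc F(1)]
    have "finprod G (\<lambda>x. x [^]\<^bsub>G\<^esub> m x) F [^]\<^bsub>G\<^esub> n = finprod G (\<lambda>x. (x [^]\<^bsub>G\<^esub> m x) [^]\<^bsub>G\<^esub> n) F" .
    moreover have "finprod G (\<lambda>x. (x [^]\<^bsub>G\<^esub> m x) [^]\<^bsub>G\<^esub> n) F = finprod G (\<lambda>x. x [^]\<^bsub>G\<^esub> (m x * n)) F"
      by (rule G.finprod_cong') (use Fc in \<open>auto simp: G.int_pow_pow\<close>)
    ultimately have "finprod G (\<lambda>x. x [^]\<^bsub>G\<^esub> (m x * n)) F = \<one>\<^bsub>G\<^esub>" by simp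
    then have "m x * n = 0" using ind[OF F, of "\<lambda>x. m x * n"] x by blast
    then show ?thesis using n by simp
  qed
  show inj: "inj_on h R"
  proof (rule inj_onI, rule ccontr)
    fix x y assume xy: "x \<in> R" "y \<in> R" "h x = h y" "x \<noteq> y"
    have c: "x \<in> carrier G" "y \<in> carrier G" using xy Rc by auto
    \<comment> \<open>Injectivity is also a case of independence: a coincidence
      \<open>h x = h y\<close> is a relation with coefficients 1 and -1.\<close>
    let ?m = "\<lambda>z. if z = x then 1 else - 1 :: int"
    have "finprod L (\<lambda>z. h z [^]\<^bsub>L\<^esub> ?m z) (insert x {y}) =
        h x [^]\<^bsub>L\<^esub> ?m x \<otimes>\<^bsub>L\<^esub> finprod L (\<lambda>z. h z [^]\<^bsub>L\<^esub> ?m z) {y}"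
      using c xy(4) by (subst L.finprod_insert) auto
    also have "\<dots> = h x [^]\<^bsub>L\<^esub> ?m x \<otimes>\<^bsub>L\<^esub> h y [^]\<^bsub>L\<^esub> ?m y"
      using c by simp
    also have "\<dots> = \<one>\<^bsub>L\<^esub>"
      using c xy(3,4) H.hom_closed by (simp add: L.int_pow_neg)
    finally have "?m x = 0" using xy by (intro key[of "{x, y}"]) auto
    then show False by simp
  qed
  show "tf_independent L (h ` R)"
    unfolding tf_independent_def
  proof (intro conjI allI impI ballI; (elim conjE)?)
    show "h ` R \<subseteq> carrier L" using Rc by auto
  next
    fix F and m :: "_ \<Rightarrow> int" and z
    assume F: "finite F" "F \<subseteq> h ` R" "finprod L (\<lambda>x. x [^]\<^bsub>L\<^esub> m x) F = \<one>\<^bsub>L\<^esub>" and z: "z \<in> F"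
    obtain E where E: "E \<subseteq> R" "F = h ` E" using F(2) by (meson subset_imageE)
    have iE: "inj_on h E" using inj E(1) by (rule inj_on_subset)
    have fE: "finite E" using F(1) iE unfolding E(2) by (rule finite_imageD)
    have "finprod L (\<lambda>x. x [^]\<^bsub>L\<^esub> m x) F = finprod L (\<lambda>x. h x [^]\<^bsub>L\<^esub> m (h x)) E"
      unfolding E(2) by (rule L.finprod_reindex[OF _ iE]) (use E(1) Rc in auto)
    then have "finprod L (\<lambda>x. h x [^]\<^bsub>L\<^esub> m (h x)) E = \<one>\<^bsub>L\<^esub>" using F(3) by simp
    moreover obtain x where "x \<in> E" "z = h x" using z E(2) by blast
    ultimately show "m z = 0" using key[OF fE E(1), of "\<lambda>x. m (h x)" x] by simp
  qed
qed

lemma Dsum_exponent: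
  assumes P: "finite P" "0 \<notin> P" and f: "f \<in> carrier (Dsum P \<gamma>)"
  shows "f [^]\<^bsub>Dsum P \<gamma>\<^esub> (\<Prod>P) = \<one>\<^bsub>Dsum P \<gamma>\<^esub>"
proof -
  have "f q [^]\<^bsub>Zsum q (\<gamma> q)\<^esub> (\<Prod>P) = \<one>\<^bsub>Zsum q (\<gamma> q)\<^esub>" if q: "q \<in> P" for q
  proof -
    have "f q \<in> carrier (Zsum q (\<gamma> q))"
      using f q unfolding Dsum_def by (auto simp: carrier_sum_group PiE_iff)
    moreover have "int q dvd int (\<Prod>P)" using P(1) q by (simp add: dvd_prodI)
    ultimately show ?thesis
      by (subst pow_sum_group) (auto simp: fun_eq_iff dvd_imp_mod_0)
  qed
  then show ?thesis
    using f unfolding Dsum_def by (subst pow_sum_group) (auto simp: fun_eq_iff)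
qed

lemma DirProd_assoc_iso: "(A \<times>\<times> B) \<times>\<times> C \<cong> A \<times>\<times> (B \<times>\<times> C)"
proof (rule is_isoI)
  show "(\<lambda>((x, y), z). (x, (y, z))) \<in> iso ((A \<times>\<times> B) \<times>\<times> C) (A \<times>\<times> (B \<times>\<times> C))"
    by (auto simp: iso_def hom_def inj_on_def bij_betw_def image_iff)
qed

lemma star_wit_infinite:
  assumes "star_wit K A" "infinite A"
  shows "infinite K"
proof
  assume "finite K"
  then have "finite (Pow K)" by simp
  moreover have "A \<lesssim> Pow K" using assms(1) by (simp add: star_wit_def)
  ultimately have "finite A" unfolding lepoll_def by (meson finite_imageD finite_subset)
  then show False using assms(2) by simp
qed

lemma comm_group_Dsum: "comm_group (Dsum P \<gamma>)"
  unfolding Dsum_def by (intro comm_group_sum_group abelian_integer_mod_group)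

lemma group_Dsum: "group (Dsum P \<gamma>)"
  using comm_group_Dsum by (rule comm_group.axioms)

lemma group_Zsum: "group (Zsum q I)"
  by (rule sum_group) simp

lemma Dsum_Un_iso: "A \<inter> B = {} \<Longrightarrow> Dsum (A \<union> B) \<gamma> \<cong> Dsum A \<gamma> \<times>\<times> Dsum B \<gamma>"
  unfolding Dsum_def by (rule is_isoI[OF sum_group_Un_iso]) (auto intro: group_Zsum)

lemma Dsum_restrict_hom:
  assumes "B \<subseteq> A"
  shows "(\<lambda>(f, x). (restrict f B, x)) \<in> hom (Dsum A \<gamma> \<times>\<times> H) (Dsum B \<gamma> \<times>\<times> H)"
proof -
  have r: "(\<lambda>f. restrict f B) \<in> hom (Dsum A \<gamma>) (Dsum B \<gamma>)"
    unfolding Dsum_def by (rule restrict_sum_group_hom[OF group_Zsum assms])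
  then show ?thesis
    by (intro homI) (auto simp: hom_mult[OF r] dest: hom_in_carrier)
qed

lemma iso_DirProd_torsion:
  assumes G: "group G" and H: "group H" and P: "finite P" "0 \<notin> P"
    and \<phi>: "\<phi> \<in> iso G (Dsum P \<gamma> \<times>\<times> H)" and g: "g \<in> carrier G" and snd: "snd (\<phi> g) = \<one>\<^bsub>H\<^esub>"
  shows "g [^]\<^bsub>G\<^esub> int (\<Prod>P) = \<one>\<^bsub>G\<^esub>"
proof -
  let ?L = "Dsum P \<gamma> \<times>\<times> H"
  interpret G: group G by fact
  interpret H: group H by fact
  interpret D: group "Dsum P \<gamma>" by (rule group_Dsum)
  interpret L: group ?L by (rule DirProd_group[OF group_Dsum H])
  interpret \<phi>: group_hom G ?L \<phi>
    using \<phi> by unfold_locales (simp add: iso_def)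
  have inj: "inj_on \<phi> (carrier G)" using \<phi> by (simp add: iso_def bij_betw_def)
  obtain f where f: "\<phi> g = (f, \<one>\<^bsub>H\<^esub>)" "f \<in> carrier (Dsum P \<gamma>)"
    using \<phi>.hom_closed[OF g] snd by (cases "\<phi> g") auto
  have "\<phi> (g [^]\<^bsub>G\<^esub> int (\<Prod>P)) = \<phi> g [^]\<^bsub>?L\<^esub> int (\<Prod>P)"
    by (rule \<phi>.hom_int_pow[OF g])
  also have "\<dots> = (f [^]\<^bsub>Dsum P \<gamma>\<^esub> int (\<Prod>P), \<one>\<^bsub>H\<^esub>)"
    unfolding f(1) by (subst int_pow_DirProd[OF group_Dsum H f(2) H.one_closed]) (simp only: H.int_pow_one)
  also have "\<dots> = \<one>\<^bsub>?L\<^esub>"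
    unfolding int_pow_int Dsum_exponent[OF P f(2)] by simp
  also have "\<dots> = \<phi> \<one>\<^bsub>G\<^esub>" by (rule \<phi>.hom_one[symmetric])
  finally show ?thesis
    by (rule inj_onD[OF inj]) (use g in auto)
qed

theorem theorem5p5:
  fixes G :: "('a, 'b) monoid_scheme" and H :: "('h, 'c) monoid_scheme"
    and P0 :: "nat set" and \<gamma> :: "nat \<Rightarrow> 'i set" and R :: "'a set" and K :: "'k set"
  assumes "comm_group G"
    and "\<exists>T. group_topology G T \<and> pseudocompact_space T"
    and "finite P0" and "P0 \<subseteq> prime_powers"
    and "comm_group H"
    and "\<forall>n::nat. n \<ge> 1 \<longrightarrow> (\<lambda>x. x [^]\<^bsub>H\<^esub> n) ` carrier H \<approx> carrier H"
    and "G \<cong> (Dsum P0 \<gamma> \<times>\<times> H)"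
    and "tf_rank_basis G R"
    and "\<forall>q \<in> dominant P0 \<gamma> R. star (\<gamma> q)"
    and "infinite R" and "star_wit K R"
    and "m_le (carrier (Dsum (P0 - dominant P0 \<gamma> R) \<gamma> \<times>\<times> H)) (Pow K)"
  shows "\<exists>T. group_topology G T \<and> pseudocompact_space T \<and> property_h G T"
proof -
  define P1 where "P1 = dominant P0 \<gamma> R"
  define P2 where "P2 = P0 - P1"
  define L where "L = Dsum P2 \<gamma> \<times>\<times> H"
  have P12: "P0 = P1 \<union> P2" "P1 \<inter> P2 = {}" "finite P1" "P2 \<subseteq> P0"
    using \<open>finite P0\<close> by (auto simp: P1_def P2_def dominant_def)
  have q1: "q > 1" if "q \<in> P0" for q
  proof -
    have "q \<in> prime_powers" using \<open>P0 \<subseteq> prime_powers\<close> that by (rule subsetD)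
    then obtain p k where "Factorial_Ring.prime p" "k \<ge> 1" "q = p ^ k"
      unfolding prime_powers_def by blast
    then show ?thesis using prime_gt_1_nat[of p] one_less_power[of p k] by simp
  qed
  have P0: "0 \<notin> P0" using q1 by force
  interpret G: comm_group G by fact
  interpret H: comm_group H by fact
  have grpL: "comm_group L" unfolding L_def by (rule comm_group_DirProd[OF comm_group_Dsum \<open>comm_group H\<close>])
  obtain \<phi> where \<phi>: "\<phi> \<in> iso G (Dsum P0 \<gamma> \<times>\<times> H)"
    using \<open>G \<cong> (Dsum P0 \<gamma> \<times>\<times> H)\<close> unfolding is_iso_def by blast
  \<comment> \<open>The projection to \<open>G_0\<close> along the dominant summands. The
    independent set \<open>R\<close> lies in \<open>G\<close>, whereas the matrix for
    \<open>L\<close> needs one of the same size inside \<open>L\<close>.\<close>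
  define \<psi> where "\<psi> = (\<lambda>(f, x). (restrict f P2, x)) \<circ> \<phi>"
  have \<psi>: "\<psi> \<in> hom G L"
    unfolding \<psi>_def L_def
    by (rule hom_compose[OF _ Dsum_restrict_hom[OF P12(4)]]) (use \<phi> in \<open>simp add: iso_def\<close>)
  \<comment> \<open>An element killed by \<psi> has trivial component in \<open>H\<close>, so it
    lies in the bounded summand, and the product of all moduli annihilates it.\<close>
  have ker: "g [^]\<^bsub>G\<^esub> int (\<Prod>P0) = \<one>\<^bsub>G\<^esub>" if "g \<in> carrier G" "\<psi> g = \<one>\<^bsub>L\<^esub>" for g
  proof (rule iso_DirProd_torsion[OF G.is_group H.is_group \<open>finite P0\<close> P0 \<phi> that(1)])
    show "snd (\<phi> g) = \<one>\<^bsub>H\<^esub>"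
      using that(2) by (cases "\<phi> g") (simp add: \<psi>_def L_def)
  qed
  have "\<Prod>P0 > 0" using P0 \<open>finite P0\<close> by (metis gr0I prod_zero_iff)
  then have "int (\<Prod>P0) > 0" by (simp only: of_nat_0_less_iff)
  note image = tf_independent_image[OF \<open>comm_group G\<close> grpL \<psi> this ker]
  have R: "tf_independent G R" using \<open>tf_rank_basis G R\<close> by (simp add: tf_rank_basis_def)
  have RR: "\<psi> ` R \<approx> R" using image(1)[OF _ _ R] by (intro inj_on_image_eqpoll_self)
  have K: "infinite K" using \<open>star_wit K R\<close> \<open>infinite R\<close> by (rule star_wit_infinite)
  have "seqs K \<lesssim> R" and "R \<lesssim> Pow K"
    using \<open>star_wit K R\<close> by (simp_all add: star_wit_def)
  have KR: "seqs K \<lesssim> \<psi> ` R" and RK: "\<psi> ` R \<lesssim> Pow K"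
    using lepoll_trans2[OF \<open>seqs K \<lesssim> R\<close> eqpoll_sym[OF RR]] lepoll_trans1[OF RR \<open>R \<lesssim> Pow K\<close>] .
  obtain D where D: "gdelta_dense (torus (carrier L)) D" "D \<lesssim> Pow K"
    using assms(12) unfolding m_le_def L_def P2_def P1_def by blast
  have "\<exists>Y. interpolating L Y"
    by (rule comm_group.exists_interpolating_of_rank[OF grpL image(2)[OF _ _ R] K KR RK D])
  moreover have "\<exists>Y. interpolating (Dsum P1 \<gamma>) Y"
    unfolding Dsum_def
  proof (rule exists_interpolating_finite_sum[OF P12(3) group_Zsum])
    fix q assume q: "q \<in> P1"
    then have "star (\<gamma> q)" using assms(9) by (simp add: P1_def)
    \<comment> \<open>Each dominant rank brings its own witness, unrelated to the \<open>K\<close>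
      used for the torsion-free rank.\<close>
    then obtain K' :: "'i set" where K': "infinite (\<gamma> q)" "star_wit K' (\<gamma> q)"
      unfolding star_def by blast
    show "\<exists>Y. interpolating (Zsum q (\<gamma> q)) Y"
      by (rule exists_interpolating_Zsum[OF _ star_wit_infinite[OF K'(2,1)]])
        (use q1[of q] q P12(1) K'(2) in \<open>auto simp: star_wit_def\<close>)
  qed
  ultimately have "\<exists>Y. interpolating (Dsum P1 \<gamma> \<times>\<times> L) Y"
    using grpL by (intro exists_interpolating_DirProd group_Dsum) (auto simp: comm_group_def)
  moreover have "G \<cong> Dsum P1 \<gamma> \<times>\<times> L"
  proof -
    obtain h where h: "h \<in> iso (Dsum P0 \<gamma>) (Dsum P1 \<gamma> \<times>\<times> Dsum P2 \<gamma>)"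
      using Dsum_Un_iso[OF P12(2)] unfolding P12(1)[symmetric] is_iso_def by blast
    have "Dsum P0 \<gamma> \<times>\<times> H \<cong> (Dsum P1 \<gamma> \<times>\<times> Dsum P2 \<gamma>) \<times>\<times> H"
      by (rule is_isoI[OF group.DirProd_iso_set_trans[OF group_Dsum h iso_set_refl]])
    with \<open>G \<cong> (Dsum P0 \<gamma> \<times>\<times> H)\<close> show ?thesis
      unfolding L_def by (metis iso_trans DirProd_assoc_iso)
  qed
  ultimately obtain Y where "interpolating G Y"
    using interpolating_is_iso[OF G.is_group DirProd_group[OF group_Dsum]] grpL comm_group_def by metis
  then show ?thesis using G.interpolating_imp_topology by blast
qed

end
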